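(* Let $X,Y$ be independent standard real Gaussian random variables and let $P\in\mathbb{C}[X,Y]$ satisfy $\mathbb{E}(P^m)=0$ for every integer $m\ge 1$. Write $P$ as a polynomial in the coordinates $Z=(X+iY)/\sqrt2$ and $W=(X-iY)/\sqrt2$. Then either every monomial $Z^aW^b$ occurring in $P$ has weight $a-b\ge 1$, or every monomial $Z^aW^b$ occurring in $P$ has weight $a-b\le -1$. Consequently, for every $Q\in\mathbb{C}[X,Y]$, $$\mathbb{E}\bigl(QP^m\bigr)=0\qquad\text{whenever } m>\deg Q.$$ In particular, the two-variable Gaussian Moments Conjecture $\mathrm{GMC}(2)$ holds, with the explicit threshold $m\ge \deg Q+1$.
   Context: $Z=(X+iY)/\sqrt2$, $W=(X-iY)/\sqrt2$ is an invertible linear change of coordinates, so $\mathbb{C}[X,Y]=\mathbb{C}[Z,W]$ and total degree $\deg$ is the same in either set of coordinates. As random variables, $W=\overline{Z}$ (so $Z,W$ are not independent). A monomial $Z^aW^b$ ($a,b\ge0$) occurs in $P$ if its coefficient in the expansion of $P$ in $Z,W$ is nonzero; its weight is $\mathrm{wt}(Z^aW^b)=a-b$. For a polynomial $P\in\mathbb{C}[X,Y]$, $\mathbb{E}(P)$ denotes the expectation of $P(X,Y)$ for $X,Y$ independent standard real Gaussians. The Gaussian Moments Conjecture $\mathrm{GMC}(n)$: let $X=(X_1,\dots,X_n)$ be a vector of independent standard real Gaussian random variables. If $P\in\mathbb{C}[x_1,\dots,x_n]$ satisfies $\mathbb{E}(P(X)^m)=0$ for all $m\ge1$, then for every $Q\in\mathbb{C}[x_1,\dots,x_n]$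 one has $\mathbb{E}(Q(X)P(X)^m)=0$ for all sufficiently large $m$. *)

theory Defs
  imports "HOL-Library.Poly_Mapping" "HOL-Probability.Probability"
begin

text \<open>
  A polynomial is a finitely supported map from monomials to coefficients, and a monomial is a
  finitely supported map from variable indices to exponents.  The ring structure is the convolution
  product of \<^theory>\<open>HOL-Library.Poly_Mapping\<close>.
\<close>

type_synonym cpoly = "(nat \<Rightarrow>\<^sub>0 nat) \<Rightarrow>\<^sub>0 complex"

definition polys :: "nat \<Rightarrow> cpoly set" where
  "polys n = {P. \<forall>m \<in> Poly_Mapping.keys P. Poly_Mapping.keys m \<subseteq> {..<n}}"

definition Const :: "complex \<Rightarrow> cpoly" where
  "Const c = Poly_Mapping.single 0 c"

definition Var :: "nat \<Rightarrow> cpoly" where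
  "Var i = Poly_Mapping.single (Poly_Mapping.single i 1) 1"

definition peval :: "(nat \<Rightarrow> complex) \<Rightarrow> cpoly \<Rightarrow> complex" where
  "peval x P = (\<Sum>m \<in> Poly_Mapping.keys P. Poly_Mapping.lookup P m *
                 (\<Prod>i \<in> Poly_Mapping.keys m. x i ^ Poly_Mapping.lookup m i))"

text \<open>The zero polynomial gets total degree 0.\<close>

definition total_degree :: "cpoly \<Rightarrow> nat" where
  "total_degree P = Max (insert 0
     ((\<lambda>m. \<Sum>i \<in> Poly_Mapping.keys m. Poly_Mapping.lookup m i) ` Poly_Mapping.keys P))"

definition std_gaussian_vector :: "'w measure \<Rightarrow> nat \<Rightarrow> (nat \<Rightarrow> 'w \<Rightarrow> real) \<Rightarrow> bool" where
  "std_gaussian_vector M n X \<longleftrightarrow>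
     prob_space M \<and>
     prob_space.indep_vars M (\<lambda>_. borel) X {..<n} \<and>
     (\<forall>i<n. distributed M lborel (X i) std_normal_density)"

definition expect :: "'w measure \<Rightarrow> (nat \<Rightarrow> 'w \<Rightarrow> real) \<Rightarrow> cpoly \<Rightarrow> complex" where
  "expect M X P = (LINT \<omega>|M. peval (\<lambda>i. complex_of_real (X i \<omega>)) P)"

text \<open>
  The sample space is fixed to be \<^typ>\<open>nat \<Rightarrow> real\<close> because a definition cannot quantify over types;
  this type carries a standard Gaussian vector of every length, as the coordinates under a product
  measure, and the expectations involved depend only on the law of the vector.
\<close>

definition GMC :: "nat \<Rightarrow> bool" where
  "GMC n \<longleftrightarrow>
     (\<forall>(M :: (nat \<Rightarrow> real) measure) X. std_gaussian_vector M n X \<longrightarrow>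
       (\<forall>P \<in> polys n. (\<forall>m\<ge>1. expect M X (P ^ m) = 0) \<longrightarrow>
         (\<forall>Q \<in> polys n. \<exists>N. \<forall>m\<ge>N. expect M X (Q * P ^ m) = 0)))"

text \<open>In two variables, \<^term>\<open>Var 0\<close> is $X$ and \<^term>\<open>Var 1\<close> is $Y$.\<close>

definition Zc :: cpoly where
  "Zc = Const (1 / complex_of_real (sqrt 2)) * (Var 0 + Const \<i> * Var 1)"

definition Wc :: cpoly where
  "Wc = Const (1 / complex_of_real (sqrt 2)) * (Var 0 - Const \<i> * Var 1)"

definition zw_poly :: "(nat \<times> nat \<Rightarrow>\<^sub>0 complex) \<Rightarrow> cpoly" where
  "zw_poly c = (\<Sum>(a, b) \<in> Poly_Mapping.keys c. Const (Poly_Mapping.lookup c (a, b)) * Zc ^ a * Wc ^ b)"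

definition zw_expansion :: "cpoly \<Rightarrow> (nat \<times> nat \<Rightarrow>\<^sub>0 complex)" where
  "zw_expansion P = (THE c. P = zw_poly c)"

definition zw_monomials :: "cpoly \<Rightarrow> (nat \<times> nat) set" where
  "zw_monomials P = Poly_Mapping.keys (zw_expansion P)"

text \<open>The expansion in $Z, W$ exists and is unique, so the description operator above is well-defined.\<close>

lemma poly_mapping_additive_induct:
  fixes p :: "'k \<Rightarrow>\<^sub>0 'c::comm_monoid_add"
  assumes "P 0"
    and s: "\<And>m c. P (Poly_Mapping.single m c)" and a: "\<And>p q. P p \<Longrightarrow> P q \<Longrightarrow> P (p + q)"
  shows "P p"
proof (induction p rule: Poly_Mapping.update_induct)
  case (update f k b)
  have "Poly_Mapping.update k b f = Poly_Mapping.single k b + f"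
    using update by (intro poly_mapping_eqI)
      (auto simp: Poly_Mapping.lookup_update lookup_add lookup_single when_def in_keys_iff)
  then show ?case using a s update by metis
qed (fact assms)

lemma peval_superset:
  assumes "finite A" "Poly_Mapping.keys P \<subseteq> A"
  shows "peval x P = (\<Sum>m \<in> A. Poly_Mapping.lookup P m *
           (\<Prod>i \<in> Poly_Mapping.keys m. x i ^ Poly_Mapping.lookup m i))"
  unfolding peval_def by (rule sum.mono_neutral_left) (use assms in \<open>auto simp: in_keys_iff\<close>)

lemma peval_add: "peval x (p + q) = peval x p + peval x q"
proof -
  let ?A = "Poly_Mapping.keys p \<union> Poly_Mapping.keys q"
  have f: "finite ?A" by simp
  show ?thesis
    using peval_superset[OF f, of p] peval_superset[OF f, of q]
      peval_superset[OF f, of "p + q"] Poly_Mapping.keys_add[of p q]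
    by (simp add: lookup_add sum.distrib algebra_simps)
qed

lemma peval_single:
  "peval x (Poly_Mapping.single m c) =
     c * (\<Prod>i \<in> Poly_Mapping.keys m. x i ^ Poly_Mapping.lookup m i)"
  by (subst peval_superset[of "{m}"]) auto

lemma monom_eval_add:
  fixes x :: "nat \<Rightarrow> complex"
  shows "(\<Prod>i \<in> Poly_Mapping.keys (m + n). x i ^ Poly_Mapping.lookup (m + n) i) =
    (\<Prod>i \<in> Poly_Mapping.keys m. x i ^ Poly_Mapping.lookup m i) *
    (\<Prod>i \<in> Poly_Mapping.keys n. x i ^ Poly_Mapping.lookup n i)"
proof -
  let ?A = "Poly_Mapping.keys m \<union> Poly_Mapping.keys n"
  have *: "(\<Prod>i \<in> Poly_Mapping.keys k. x i ^ Poly_Mapping.lookup k i) =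
        (\<Prod>i \<in> ?A. x i ^ Poly_Mapping.lookup k i)" if "Poly_Mapping.keys k \<subseteq> ?A" for k
    by (rule prod.mono_neutral_left) (use that in \<open>auto simp: in_keys_iff\<close>)
  show ?thesis
    unfolding *[OF Poly_Mapping.keys_add] *[OF Un_upper1] *[OF Un_upper2]
    by (simp add: lookup_add power_add prod.distrib)
qed

lemma peval_mult: "peval x (p * q) = peval x p * peval x q"
proof (induction p rule: poly_mapping_additive_induct)
  case (2 m c)
  show ?case
    by (induction q rule: poly_mapping_additive_induct)
      (auto simp: peval_def[of _ 0] mult_single peval_single monom_eval_add peval_add algebra_simps)
qed (auto simp: peval_def[of _ 0] peval_add algebra_simps)

lemma peval_Const: "peval x (Const c) = c"
  by (simp add: Const_def peval_single)

lemma peval_Var: "peval x (Var i) = x i"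
  by (simp add: Var_def peval_single)

lemma peval_power: "peval x (p ^ m) = peval x p ^ m"
proof (induction m)
  case 0
  then show ?case using peval_Const[of x 1] by (simp add: Const_def)
qed (simp add: peval_mult)

lemma peval_diff: "peval x (p - q) = peval x p - peval x q"
  using peval_add[of x "p - q" q] by simp

lemma peval_sum: "peval x (sum f A) = (\<Sum>a\<in>A. peval x (f a))"
  by (induction A rule: infinite_finite_induct) (auto simp: peval_add peval_def[of _ 0])

lemma zw_poly_superset:
  assumes "finite A" "Poly_Mapping.keys c \<subseteq> A"
  shows "zw_poly c = (\<Sum>(a, b) \<in> A. Const (Poly_Mapping.lookup c (a, b)) * Zc ^ a * Wc ^ b)"
  unfolding zw_poly_def
  by (rule sum.mono_neutral_left) (use assms in \<open>auto simp: in_keys_iff Const_def\<close>)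

lemma zw_poly_add: "zw_poly (p + q) = zw_poly p + zw_poly q"
proof -
  let ?A = "Poly_Mapping.keys p \<union> Poly_Mapping.keys q"
  have f: "finite ?A" by simp
  show ?thesis
    using zw_poly_superset[OF f, of p] zw_poly_superset[OF f, of q]
      zw_poly_superset[OF f, of "p + q"] Poly_Mapping.keys_add[of p q]
    by (simp add: lookup_add sum.distrib algebra_simps Const_def single_add case_prod_beta)
qed

lemma zw_poly_single: "zw_poly (Poly_Mapping.single (a, b) r) = Const r * Zc ^ a * Wc ^ b"
  by (subst zw_poly_superset[of "{(a, b)}"]) auto

lemma zw_poly_0: "zw_poly 0 = 0"
  by (simp add: zw_poly_def)

lemma Const_mult: "Const (r * s) = Const r * Const s"
  by (simp add: Const_def mult_single)

lemma Const_add: "Const (r + s) = Const r + Const s"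
  by (simp add: Const_def single_add)

lemma Const_1: "Const 1 = 1"
  by (simp add: Const_def)

lemma zw_poly_mult: "zw_poly p * zw_poly q \<in> range zw_poly"
proof (induction p rule: poly_mapping_additive_induct)
  case 1
  show ?case using zw_poly_0 by (metis mult_zero_left rangeI)
next
  case (2 m c)
  show ?case
  proof (induction q rule: poly_mapping_additive_induct)
    case 1
    show ?case using zw_poly_0 by (metis mult_zero_right rangeI)
  next
    case (2 n d)
    obtain a b a' b' where mn: "m = (a, b)" "n = (a', b')" by fastforce
    have "zw_poly (Poly_Mapping.single m c) * zw_poly (Poly_Mapping.single n d) =
        zw_poly (Poly_Mapping.single (a + a', b + b') (c * d))"
      unfolding mn zw_poly_single Const_mult power_add by (simp add: algebra_simps)
    then show ?case by blast
  next
    case (3 p q)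
    then show ?case by (auto simp: zw_poly_add distrib_left) (metis rangeI zw_poly_add)
  qed
next
  case (3 p q)
  then show ?case by (auto simp: zw_poly_add distrib_right) (metis rangeI zw_poly_add)
qed

lemma range_zw_poly_mult: "p \<in> range zw_poly \<Longrightarrow> q \<in> range zw_poly \<Longrightarrow> p * q \<in> range zw_poly"
  using zw_poly_mult by blast

lemma range_zw_poly_add: "p \<in> range zw_poly \<Longrightarrow> q \<in> range zw_poly \<Longrightarrow> p + q \<in> range zw_poly"
  by (metis (no_types, lifting) imageE rangeI zw_poly_add)

lemma Const_in_range_zw_poly: "Const r \<in> range zw_poly"
  using zw_poly_single[of 0 0 r] by (metis mult.right_neutral power_0 rangeI)

lemma range_zw_poly_power: "p \<in> range zw_poly \<Longrightarrow> p ^ k \<in> range zw_poly"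
proof (induction k)
  case 0
  then show ?case using Const_in_range_zw_poly[of 1] by (simp add: Const_1)
qed (auto intro: range_zw_poly_mult)

lemma sqrt2_sq: "complex_of_real (sqrt 2) * complex_of_real (sqrt 2) = 2"
  by (metis of_real_mult of_real_numeral real_sqrt_mult_self abs_numeral)

lemma Var_in_range_zw_poly: "Var 0 \<in> range zw_poly" "Var 1 \<in> range zw_poly"
proof -
  let ?r = "1 / complex_of_real (sqrt 2)"
  have rr: "?r * ?r * 2 = 1" using sqrt2_sq by (simp add: field_simps)
  have Z: "Zc \<in> range zw_poly"
    using zw_poly_single[of 1 0 1] by (metis Const_1 mult.right_neutral mult_1 power_0 power_one_right rangeI)
  have W: "Wc \<in> range zw_poly"
    using zw_poly_single[of 0 1 1] by (metis Const_1 mult.right_neutral mult_1 power_0 power_one_right rangeI)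
  have "Const ?r * (Zc + Wc) = Const (?r * ?r * 2) * Var 0"
    unfolding Zc_def Wc_def Const_mult
    using Const_add[of 1 1] by (simp add: Const_1 algebra_simps)
  then have "Var 0 = Const ?r * (Zc + Wc)"
    unfolding rr by (simp add: Const_1)
  then show "Var 0 \<in> range zw_poly"
    using range_zw_poly_mult[OF Const_in_range_zw_poly range_zw_poly_add[OF Z W]] by metis
  have m1: "Const (-1) * p = - p" for p
    by (simp add: Const_def single_uminus)
  have "Const (- \<i> * ?r) * (Zc + Const (-1) * Wc) = Const ((- \<i> * \<i>) * (?r * ?r * 2)) * Var 1"
    unfolding Zc_def Wc_def m1
    unfolding Const_mult
    using Const_add[of 1 1] by (simp add: Const_1 algebra_simps)
  then have "Var 1 = Const (- \<i> * ?r) * (Zc + Const (-1) * Wc)"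
    unfolding rr by (simp add: Const_1)
  then show "Var 1 \<in> range zw_poly"
    using range_zw_poly_mult[OF Const_in_range_zw_poly range_zw_poly_add[OF Z
        range_zw_poly_mult[OF Const_in_range_zw_poly W]]] by metis
qed

lemma Var_power: "Var i ^ k = Poly_Mapping.single (Poly_Mapping.single i k) 1"
  by (induction k) (auto simp: Var_def mult_single single_add[symmetric] simp flip: single_one)

lemma range_zw_poly_polys2:
  assumes "P \<in> polys 2"
  shows "P \<in> range zw_poly"
proof -
  have "(\<Sum>m \<in> A. Poly_Mapping.single m (Poly_Mapping.lookup P m)) \<in> range zw_poly"
    if "finite A" "A \<subseteq> Poly_Mapping.keys P" for A
    using that
  proof (induction A rule: finite_induct)
    case empty
    show ?case using zw_poly_0 by (metis sum.empty rangeI)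
  next
    case (insert m A)
    have km: "Poly_Mapping.keys m \<subseteq> {..<2}"
      using assms insert.prems by (auto simp: polys_def)
    have m: "m = Poly_Mapping.single 0 (Poly_Mapping.lookup m 0) + Poly_Mapping.single 1 (Poly_Mapping.lookup m 1)"
    proof (rule poly_mapping_eqI)
      fix k
      have "Poly_Mapping.lookup m k = 0" if "k \<noteq> 0" "k \<noteq> 1"
        using km that by (metis in_keys_iff lessThan_iff less_2_cases One_nat_def subsetD)
      then show "Poly_Mapping.lookup m k = Poly_Mapping.lookup (Poly_Mapping.single 0 (Poly_Mapping.lookup m 0) + Poly_Mapping.single 1 (Poly_Mapping.lookup m 1)) k"
        by (auto simp: lookup_add lookup_single when_def)
    qed
    have "Poly_Mapping.single m r = Const r * Var 0 ^ Poly_Mapping.lookup m 0 * Var 1 ^ Poly_Mapping.lookup m 1" for r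
      by (subst m) (simp add: Const_def Var_power mult_single)
    then have "Poly_Mapping.single m r \<in> range zw_poly" for r
      using Const_in_range_zw_poly Var_in_range_zw_poly
      by (metis range_zw_poly_mult range_zw_poly_power)
    then show ?case
      using insert range_zw_poly_add by auto
  qed
  moreover have "P = (\<Sum>m \<in> Poly_Mapping.keys P. Poly_Mapping.single m (Poly_Mapping.lookup P m))"
    by (rule poly_mapping_eqI)
      (auto simp: lookup_sum lookup_single when_def in_keys_iff)
  ultimately show ?thesis
    by (metis finite_keys order_refl)
qed

lemma peval_zw_poly:
  "peval x (zw_poly c) = (\<Sum>(a, b) \<in> Poly_Mapping.keys c. Poly_Mapping.lookup c (a, b) *
      peval x Zc ^ a * peval x Wc ^ b)"
  unfolding zw_poly_def
  by (simp add: peval_sum peval_mult peval_power peval_Const case_prod_beta)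

lemma zw_poly_diff: "zw_poly (p - q) = zw_poly p - zw_poly q"
  using zw_poly_add[of "p - q" q] by simp

lemma zw_poly_eq_0:
  assumes "zw_poly c = 0"
  shows "c = 0"
proof (rule poly_mapping_eqI)
  fix k :: "nat \<times> nat"
  obtain i j where k: "k = (i, j)" by fastforce
  let ?l = "Poly_Mapping.lookup c"
  obtain N where N: "insert k (Poly_Mapping.keys c) \<subseteq> {..N} \<times> {..N}"
  proof -
    let ?B = "insert k (Poly_Mapping.keys c)"
    have max: "a \<le> Max (fst ` ?B \<union> snd ` ?B) \<and> b \<le> Max (fst ` ?B \<union> snd ` ?B)" if "(a, b) \<in> ?B" for a b
      using that by (intro conjI Max_ge) force+
    show thesis
    proof (rule that, rule subsetI)
      show "p \<in> {..Max (fst ` ?B \<union> snd ` ?B)} \<times> {..Max (fst ` ?B \<union> snd ` ?B)}" if "p \<in> ?B" for p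
        using max[of "fst p" "snd p"] that by (simp only: prod.collapse mem_Times_iff atMost_iff)
    qed
  qed
  have *: "(\<Sum>a\<le>N. (\<Sum>b\<le>N. ?l (a, b) * w ^ b) * z ^ a) = 0" for z w :: complex
  proof -
    let ?r = "1 / complex_of_real (sqrt 2)"
    define x where "x i = (if i = 0 then ?r * (z + w) else - \<i> * ?r * (z - w))" for i :: nat
    have rr: "?r * ?r * 2 = 1" using sqrt2_sq by (simp add: field_simps)
    have "peval x Zc = (?r * ?r * 2) * z" "peval x Wc = (?r * ?r * 2) * w"
      by (simp_all only: Zc_def Wc_def peval_mult peval_add peval_diff peval_Const peval_Var)
        (auto simp: x_def algebra_simps add_divide_distrib diff_divide_distrib)
    then have "peval x Zc = z" "peval x Wc = w"
      unfolding rr by simp_all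
    then have "(\<Sum>(a, b) \<in> Poly_Mapping.keys c. ?l (a, b) * z ^ a * w ^ b) = 0"
      using peval_zw_poly[of x c] assms by (simp add: peval_def[of _ 0])
    also have "(\<Sum>(a, b) \<in> Poly_Mapping.keys c. ?l (a, b) * z ^ a * w ^ b) =
        (\<Sum>(a, b) \<in> {..N} \<times> {..N}. ?l (a, b) * z ^ a * w ^ b)"
      by (rule sum.mono_neutral_left) (use N in \<open>auto simp: in_keys_iff\<close>)
    finally show ?thesis
      by (simp add: sum.cartesian_product[symmetric] sum_distrib_left sum_distrib_right mult_ac)
  qed
  then have "(\<Sum>b\<le>N. ?l (i, b) * w ^ b) = 0" for w
    using polyfun_eq_0[of "\<lambda>a. \<Sum>b\<le>N. ?l (a, b) * w ^ b" N] N k by auto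
  then show "?l k = Poly_Mapping.lookup 0 k"
    using polyfun_eq_0[of "\<lambda>b. ?l (i, b)" N] N k by auto
qed

lemma zw_expansion_ex1:
  assumes "P \<in> polys 2"
  shows "\<exists>!c. P = zw_poly c"
  using range_zw_poly_polys2[OF assms] zw_poly_eq_0 zw_poly_diff
  by (metis (no_types, lifting) imageE eq_iff_diff_eq_0)

lemma zw_poly_zw_expansion: "P \<in> polys 2 \<Longrightarrow> zw_poly (zw_expansion P) = P"
  unfolding zw_expansion_def by (rule theI'[OF zw_expansion_ex1, symmetric])

text \<open>The hypothesis in \<^const>\<open>GMC\<close> is satisfiable over its fixed sample space.\<close>

lemma std_gaussian_vector_exists:
  "\<exists>(M :: (nat \<Rightarrow> real) measure) X. std_gaussian_vector M n X"
proof -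
  let ?G = "density lborel std_normal_density"
  let ?M = "PiM UNIV (\<lambda>_ :: nat. ?G)"
  have G: "prob_space ?G" by (rule prob_space_normal_density) simp
  then interpret P: product_prob_space "\<lambda>_ :: nat. ?G" UNIV
    by (simp add: product_prob_space_def product_sigma_finite_def product_prob_space_axioms_def
        prob_space_imp_sigma_finite)
  have comp: "distr ?M ?G (\<lambda>\<omega>. \<omega> i) = ?G" for i
    using distr_PiM_component[of UNIV "\<lambda>_. ?G" i] G by simp
  have comp': "distr ?M borel (\<lambda>\<omega>. \<omega> i) = ?G" for i
    using comp[of i] by (metis distr_cong sets_density sets_lborel)
  have rv: "(\<lambda>\<omega>. \<omega> i) \<in> ?M \<rightarrow>\<^sub>M borel" for i
    using measurable_component_singleton[of i UNIV "\<lambda>_. ?G"]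
    by (simp cong: measurable_cong_sets)
  have "P.P.indep_vars (\<lambda>_. borel) (\<lambda>i \<omega>. \<omega> i) UNIV"
  proof (subst P.P.indep_vars_iff_distr_eq_PiM')
    show "distr ?M (PiM UNIV (\<lambda>_. borel)) (\<lambda>x. \<lambda>i\<in>UNIV. x i) =
        PiM UNIV (\<lambda>i. distr ?M borel (\<lambda>\<omega>. \<omega> i))"
      unfolding comp' restrict_UNIV
      by (subst distr_id2) (auto intro!: sets_PiM_cong)
  qed (use rv in auto)
  then have "P.P.indep_vars (\<lambda>_. borel) (\<lambda>i \<omega>. \<omega> i) {..<n}"
    by (rule P.P.indep_vars_subset) simp
  moreover have "distributed ?M lborel (\<lambda>\<omega>. \<omega> i) std_normal_density" for i
    unfolding distributed_def using comp'[of i] rv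
    by (auto simp: distr_cong[of ?M ?M lborel borel] measurable_lborel1)
  ultimately show ?thesis
    unfolding std_gaussian_vector_def using P.P.prob_space_axioms by blast
qed

end

theory Submission
  imports Defs "Jordan_Normal_Form.Char_Poly"
begin

text \<open>
  Since \<open>W\<close> is the complex conjugate of the standard complex Gaussian \<open>Z\<close>, the expectation of
  \<open>Z ^ a W ^ b\<close> is \<open>a!\<close> if \<open>a = b\<close> and \<open>0\<close> otherwise (\<open>integral_ZW\<close>).  So the moments of \<open>P\<close> are
  \<open>\<Sum>k. k! C(m, k)\<close>, where \<open>C(m, k)\<close> is the coefficient of \<open>Z ^ k W ^ k\<close> in \<open>P ^ m\<close>.  The statement on
  \<open>Q P ^ m\<close> follows from the statement on weights: if all weights in \<open>P\<close> are at least 1, those in \<open>P ^ m\<close> are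
  at least \<open>m\<close>, and multiplication by \<open>Q\<close> lowers them by at most the degree of \<open>Q\<close>, so no diagonal monomial
  is left.

  For the weights, suppose that \<open>P\<close> has a monomial of weight \<open>\<ge> 0\<close> and one of weight \<open>\<le> 0\<close>.  Then the
  diagonal meets the Newton polygon of \<open>P\<close>, and enters it at a point \<open>(\<alpha>, \<alpha>)\<close> on its lower boundary.  Hence
  \<open>C(m, k) = 0\<close> for \<open>k < \<alpha> m\<close>, and \<open>C(m, \<alpha> m)\<close> is the constant term of the \<open>m\<close>-th power of a Laurent
  polynomial in one variable, which collects the terms of \<open>P\<close> on an edge or is a single monomial.  By the
  theorem of Duistermaat and van der Kallen in one variable (\<open>constant_term_power_nonzero\<close>),
  \<open>g = C(m, \<alpha> m)\<close> is nonzero for some \<open>m \<ge> 1\<close> (\<open>diagonal_coefficient_on_lower_boundary\<close>).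

  Now let \<open>p\<close> be a prime and consider the power \<open>m p\<close>.  Divide the moment by \<open>(\<alpha> m p)!\<close>.  By Frobenius
  the lowest term is \<open>g ^ p\<close> modulo \<open>p\<close>, and every other term is divisible by \<open>p\<close>, either because its
  coefficient is or because the factorial quotient is (\<open>diagonal_coefficient_power_divisible\<close>).  If the
  moment vanishes, \<open>g ^ p\<close> is divisible by \<open>p\<close> in the ring generated by the coefficients of \<open>P\<close>.  But in a
  finitely generated ring of complex numbers this happens for only finitely many \<open>p\<close>
  (\<open>finitely_generated_subring_few_inverted_primes\<close>).

  The one-variable theorem is proved as follows.  Suppose that all powers of \<open>f(x) = q(x) / x ^ u\<close> have constant
  term \<open>0\<close>.  For large \<open>s\<close> the mean of \<open>log (1 - f / s)\<close> over the unit circle vanishes, and a discrete form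
  of Jensen's formula shows that the roots of \<open>f(x) = s\<close> inside the circle have product \<open>q(0) / s\<close>, up to sign
  (\<open>small_roots_product\<close>).  The roots are integral over \<open>\<complex>[s]\<close>, hence so is \<open>1 / s\<close>, a contradiction.
\<close>

section \<open>Functions integral over polynomials\<close>

text \<open>
  \<open>integral_on T y\<close> says that the function \<open>y\<close> on \<open>T\<close> is integral over the ring \<open>\<complex>[s]\<close> of polynomial
  functions: one monic polynomial, with coefficients in \<open>\<complex>[s]\<close>, annihilates \<open>y s\<close> at every \<open>s\<close> in \<open>T\<close>.
  A relation that is uniform in \<open>s\<close> is what allows a conclusion about large \<open>s\<close> to be carried to
  \<open>s = 0\<close>, with no analytic continuation of the individual roots.
\<close>

definition integral_on :: "complex set \<Rightarrow> (complex \<Rightarrow> complex) \<Rightarrow> bool" where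
  "integral_on T y \<longleftrightarrow> (\<exists>P :: complex poly poly. lead_coeff P = 1 \<and> (\<forall>s\<in>T. poly (poly P [:y s:]) s = 0))"

lemma poly_map_poly_eval:
  fixes P :: "complex poly poly"
  shows "poly (map_poly (\<lambda>c. poly c s) P) k = poly (poly P [:k:]) s"
proof (induction P)
  case (pCons a P)
  have "map_poly (\<lambda>c. poly c s) (pCons a P) = pCons (poly a s) (map_poly (\<lambda>c. poly c s) P)"
    by (cases "a = 0 \<and> P = 0") (auto simp: map_poly_pCons)
  then show ?case using pCons by (simp add: algebra_simps)
qed simp

lemma sum_div_mod:
  fixes f :: "nat \<Rightarrow> nat \<Rightarrow> 'a::comm_monoid_add"
  shows "(\<Sum>l<n * m. f (l div m) (l mod m)) = (\<Sum>i<n. \<Sum>j<m. f i j)"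
proof (cases "m = 0")
  case False
  have "(\<Sum>l<n * m. f (l div m) (l mod m)) = (\<Sum>i<n. \<Sum>l=i*m..<i*m+m. f (l div m) (l mod m))"
    by (rule sum.nat_group[symmetric])
  also have "\<dots> = (\<Sum>i<n. \<Sum>j<m. f i j)"
  proof (rule sum.cong[OF refl])
    fix i
    show "(\<Sum>l=i*m..<i*m+m. f (l div m) (l mod m)) = (\<Sum>j<m. f i j)"
      using False sum.shift_bounds_nat_ivl[of "\<lambda>l. f (l div m) (l mod m)" 0 "i * m" m]
      by (simp add: atLeast0LessThan add.commute)
  qed
  finally show ?thesis .
qed simp

lemma integral_on_power_reduction:
  assumes P: "lead_coeff P = 1" "\<forall>s\<in>T. poly (poly P [:y s:]) s = 0"
  obtains C :: "nat \<Rightarrow> nat \<Rightarrow> complex poly" where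
    "\<And>s i. s \<in> T \<Longrightarrow> i < degree P \<Longrightarrow> y s * y s ^ i = (\<Sum>l<degree P. poly (C i l) s * y s ^ l)"
proof
  define n where "n = degree P"
  define C where "C i l = (if Suc i < n then (if l = Suc i then 1 else 0) else - coeff P l)" for i l
  fix s i assume s: "s \<in> T" and i: "i < degree P"
  have "0 = poly (poly P [:y s:]) s" using P s by simp
  also have "\<dots> = (\<Sum>l\<le>n. poly (coeff P l) s * y s ^ l)"
    by (simp add: poly_altdef[of P] poly_sum poly_power n_def)
  also have "\<dots> = (\<Sum>l<n. poly (coeff P l) s * y s ^ l) + y s ^ n"
    using P by (simp add: lessThan_Suc_atMost[symmetric] n_def)
  finally have top: "y s ^ n = (\<Sum>l<n. - (poly (coeff P l) s * y s ^ l))"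
    by (simp add: sum_negf eq_neg_iff_add_eq_0 add.commute)
  have "y s * y s ^ i = (\<Sum>l<n. poly (C i l) s * y s ^ l)"
  proof (cases "Suc i < n")
    case True
    have "(\<Sum>l<n. poly (C i l) s * y s ^ l) = (\<Sum>l<n. if l = Suc i then y s ^ l else 0)"
      by (rule sum.cong) (use True in \<open>auto simp: C_def\<close>)
    then show ?thesis using True by simp
  next
    case False
    then have "Suc i = n" using i by (simp add: n_def)
    then show ?thesis using top False by (auto simp: C_def simp flip: power_Suc)
  qed
  then show "y s * y s ^ i = (\<Sum>l<degree P. poly (C i l) s * y s ^ l)" by (simp add: n_def)
qed

text \<open>
  If \<open>y\<close> and \<open>z\<close> satisfy monic equations of degrees \<open>n\<close> and \<open>m\<close>, multiplication with \<open>y * z\<close> maps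
  the products \<open>y ^ i * z ^ j\<close> with \<open>i < n\<close> and \<open>j < m\<close> to \<open>\<complex>[s]\<close>-combinations of themselves.  The matrix of
  this map has \<open>y s * z s\<close> as an eigenvalue for every \<open>s\<close>, hence its characteristic polynomial is the
  monic polynomial sought.
\<close>

lemma integral_on_mult:
  assumes "integral_on T y" "integral_on T z"
  shows "integral_on T (\<lambda>s. y s * z s)"
proof (cases "T = {}")
  case True
  then show ?thesis unfolding integral_on_def by (intro exI[of _ 1]) simp
next
  case False
  then obtain s0 where s0: "s0 \<in> T" by blast
  obtain P where P: "lead_coeff P = 1" "\<forall>s\<in>T. poly (poly P [:y s:]) s = 0"
    using assms(1) unfolding integral_on_def by blast
  obtain Q where Q: "lead_coeff Q = 1" "\<forall>s\<in>T. poly (poly Q [:z s:]) s = 0"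
    using assms(2) unfolding integral_on_def by blast
  define n m where "n = degree P" and "m = degree Q"
  have n0: "n > 0"
  proof (rule ccontr)
    assume "\<not> n > 0"
    then have "P = 1" using P(1) by (metis n_def degree_eq_zeroE gr0I lead_coeff_pCons(2) one_pCons)
    then show False using P(2) s0 by simp
  qed
  have m0: "m > 0"
  proof (rule ccontr)
    assume "\<not> m > 0"
    then have "Q = 1" using Q(1) by (metis m_def degree_eq_zeroE gr0I lead_coeff_pCons(2) one_pCons)
    then show False using Q(2) s0 by simp
  qed
  obtain C where C: "\<And>s i. s \<in> T \<Longrightarrow> i < n \<Longrightarrow> y s * y s ^ i = (\<Sum>l<n. poly (C i l) s * y s ^ l)"
    using integral_on_power_reduction[OF P] unfolding n_def by blast
  obtain D where D: "\<And>s i. s \<in> T \<Longrightarrow> i < m \<Longrightarrow> z s * z s ^ i = (\<Sum>l<m. poly (D i l) s * z s ^ l)"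
    using integral_on_power_reduction[OF Q] unfolding m_def by blast
  \<comment> \<open>The pair of exponents \<open>(i, j)\<close> is stored as the index \<open>i * m + j\<close>.\<close>
  define A where "A = Matrix.mat (n * m) (n * m) (\<lambda>(k, l). C (k div m) (l div m) * D (k mod m) (l mod m))"
  have A: "A \<in> carrier_mat (n * m) (n * m)" by (simp add: A_def)
  have "poly (poly (char_poly A) [:y s * z s:]) s = 0" if s: "s \<in> T" for s
  proof -
    have ev: "comm_ring_hom (\<lambda>c :: complex poly. poly c s)"
      by unfold_locales auto
    define B where "B = map_mat (\<lambda>c. poly c s) A"
    have B: "B \<in> carrier_mat (n * m) (n * m)" using A by (simp add: B_def)
    define v where "v = Matrix.vec (n * m) (\<lambda>k. y s ^ (k div m) * z s ^ (k mod m))"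
    have "vec_index v 0 = 1" using n0 m0 by (simp add: v_def)
    then have v0: "v \<noteq> 0\<^sub>v (n * m)" using n0 m0 by auto
    have Bv: "B *\<^sub>v v = (y s * z s) \<cdot>\<^sub>v v"
    proof (rule eq_vecI)
      fix k assume "k < dim_vec ((y s * z s) \<cdot>\<^sub>v v)"
      then have k: "k < n * m" by (simp add: v_def)
      then have i: "k div m < n" and j: "k mod m < m"
        using m0 by (auto simp: less_mult_imp_div_less)
      have "vec_index (B *\<^sub>v v) k = (\<Sum>l<n * m. (poly (C (k div m) (l div m)) s * poly (D (k mod m) (l mod m)) s)
          * (y s ^ (l div m) * z s ^ (l mod m)))"
        using k A by (simp add: B_def A_def v_def scalar_prod_def atLeast0LessThan)
      also have "\<dots> = (\<Sum>i<n. \<Sum>j<m. (poly (C (k div m) i) s * poly (D (k mod m) j) s)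
          * (y s ^ i * z s ^ j))"
        by (rule sum_div_mod)
      also have "\<dots> = (\<Sum>l<n. poly (C (k div m) l) s * y s ^ l) * (\<Sum>l<m. poly (D (k mod m) l) s * z s ^ l)"
        by (simp add: sum_product mult_ac)
      also have "\<dots> = (y s * y s ^ (k div m)) * (z s * z s ^ (k mod m))"
        using C[OF s i] D[OF s j] by simp
      also have "\<dots> = vec_index ((y s * z s) \<cdot>\<^sub>v v) k"
        using k by (simp add: v_def)
      finally show "vec_index (B *\<^sub>v v) k = vec_index ((y s * z s) \<cdot>\<^sub>v v) k" .
    qed (use B in \<open>auto simp: v_def\<close>)
    have "eigenvalue B (y s * z s)"
      unfolding eigenvalue_def eigenvector_def using v0 Bv B by (intro exI[of _ v]) (auto simp: v_def)
    then have "poly (char_poly B) (y s * z s) = 0"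
      using eigenvalue_root_char_poly[OF B] by simp
    moreover have "char_poly B = map_poly (\<lambda>c. poly c s) (char_poly A)"
      unfolding B_def by (rule comm_ring_hom.char_poly_hom[OF ev A])
    ultimately show ?thesis by (simp add: poly_map_poly_eval)
  qed
  moreover have "lead_coeff (char_poly A) = 1"
    using degree_monic_char_poly[OF A] by simp
  ultimately show ?thesis unfolding integral_on_def by blast
qed

lemma integral_on_prod:
  fixes k :: nat
  assumes "\<And>i. i < k \<Longrightarrow> integral_on T (y i)"
  shows "integral_on T (\<lambda>s. \<Prod>i<k. y i s)"
  using assms
proof (induction k)
  case 0
  show ?case unfolding integral_on_def by (intro exI[of _ "[:-1, 1:]"]) simp
next
  case (Suc k)
  then show ?case using integral_on_mult[of T "\<lambda>s. \<Prod>i<k. y i s" "y k"] by simp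
qed

text \<open>
  Morally \<open>y = c / s ^ k\<close> has a pole at \<open>0\<close>, while \<open>\<complex>[s]\<close> is integrally closed.  Clearing
  denominators in the monic equation gives a polynomial in \<open>s\<close> with infinitely many zeros whose value
  at \<open>0\<close> is a power of \<open>c\<close>.
\<close>

lemma not_integral_on_inverse_power:
  assumes "infinite T" "integral_on T y" "c \<noteq> 0" "k > 0"
  shows "\<exists>s\<in>T. s ^ k * y s \<noteq> c"
proof (rule ccontr)
  assume "\<not> ?thesis"
  then have y: "s ^ k * y s = c" if "s \<in> T" for s using that by blast
  obtain P where P: "lead_coeff P = 1" "\<forall>s\<in>T. poly (poly P [:y s:]) s = 0"
    using assms(2) unfolding integral_on_def by blast
  define N where "N = degree P"
  define R where "R = (\<Sum>i\<le>N. coeff P i * [:c ^ i:] * monom 1 (k * (N - i)))"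
  have "poly R s = 0" if s: "s \<in> T" for s
  proof -
    have "poly R s = (\<Sum>i\<le>N. poly (coeff P i) s * c ^ i * s ^ (k * (N - i)))"
      by (simp add: R_def poly_sum poly_monom mult_ac)
    also have "\<dots> = (\<Sum>i\<le>N. s ^ (k * N) * (poly (coeff P i) s * y s ^ i))"
    proof (rule sum.cong[OF refl])
      fix i assume "i \<in> {..N}"
      then have "k * N = k * i + k * (N - i)" by (simp add: algebra_simps)
      then have "s ^ (k * N) = s ^ (k * i) * s ^ (k * (N - i))" by (metis power_add)
      moreover have "c ^ i = s ^ (k * i) * y s ^ i" using y[OF s] by (metis power_mult power_mult_distrib)
      ultimately show "poly (coeff P i) s * c ^ i * s ^ (k * (N - i)) = s ^ (k * N) * (poly (coeff P i) s * y s ^ i)"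
        by (simp add: mult_ac)
    qed
    also have "\<dots> = s ^ (k * N) * poly (poly P [:y s:]) s"
      by (simp add: poly_altdef[of P] poly_sum poly_power N_def sum_distrib_left)
    finally show ?thesis using P s by simp
  qed
  then have "T \<subseteq> {s. poly R s = 0}" by blast
  then have "R = 0" using assms(1) poly_roots_finite[of R] finite_subset by blast
  then have "0 = poly R 0" by simp
  also have "\<dots> = (\<Sum>i\<le>N. if i = N then c ^ N else 0)"
    unfolding R_def poly_sum
    by (rule sum.cong) (use P \<open>k > 0\<close> in \<open>auto simp: poly_monom N_def power_0_left\<close>)
  also have "\<dots> = c ^ N" by simp
  finally show False using \<open>c \<noteq> 0\<close> by simp
qed

section \<open>Constant terms of powers of a Laurent polynomial\<close>

abbreviation unity_roots :: "nat \<Rightarrow> complex set" where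
  "unity_roots N \<equiv> {z. z ^ N = 1}"

lemma prod_diff_unity_roots:
  assumes "N > 0"
  shows "(\<Prod>z\<in>unity_roots N. a - z) = a ^ N - 1"
proof -
  have fin: "finite (unity_roots N)" using finite_roots_unity[of N] assms by simp
  have card: "card (unity_roots N) = N" using card_roots_unity_eq[OF assms] by simp
  let ?p = "\<Prod>z\<in>unity_roots N. [:-z, 1:]" and ?q = "monom 1 N - 1 :: complex poly"
  have deg: "degree ?p = N" using card by (subst degree_prod_eq_sum_degree) auto
  have "lead_coeff ?p = 1" by (simp add: lead_coeff_prod)
  then have lc: "coeff ?p N = coeff ?q N" using deg assms by simp
  have "?p = ?q"
  proof (rule poly_eqI_degree_lead_coeff[OF lc])
    show "card (unity_roots N) \<ge> N" using card by simp
    show "degree ?p \<le> N" using deg by simp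
    show "degree ?q \<le> N" by (intro degree_diff_le degree_monom_le) simp
  qed (use fin in \<open>auto simp: poly_prod poly_monom prod_zero_iff\<close>)
  then have "poly ?p a = poly ?q a" by simp
  then show ?thesis by (simp add: poly_prod poly_monom)
qed

lemma sum_unity_roots_power_quotient:
  assumes "a < N" "b < N" "a \<noteq> b"
  shows "(\<Sum>z\<in>unity_roots N. z ^ a / z ^ b) = 0"
proof -
  define w where "w = exp (2 * of_real pi * \<i> * of_nat 1 / of_nat N)"
  have wp: "w ^ k = exp (2 * of_real pi * \<i> * of_nat k / of_nat N)" for k
    unfolding w_def exp_of_nat_mult[symmetric] by (rule arg_cong[of _ _ exp]) simp
  have N: "w ^ N = 1" using assms complex_root_unity_eq_1[of N N] by (simp add: wp)
  have w0: "w \<noteq> 0" unfolding w_def by (rule exp_not_eq_zero)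
  have "w ^ a \<noteq> w ^ b" unfolding wp using assms by (subst complex_root_unity_eq) auto
  then have ne: "w ^ a / w ^ b \<noteq> 1" using w0 by simp
  have "(\<Sum>z\<in>unity_roots N. z ^ a / z ^ b) = (\<Sum>z\<in>unity_roots N. (w * z) ^ a / (w * z) ^ b)"
    by (rule sum.reindex_bij_witness[of _ "\<lambda>z. w * z" "\<lambda>z. z / w"])
      (use N w0 in \<open>auto simp: power_mult_distrib power_divide\<close>)
  also have "\<dots> = w ^ a / w ^ b * (\<Sum>z\<in>unity_roots N. z ^ a / z ^ b)"
    by (simp add: power_mult_distrib sum_distrib_left)
  finally have "(1 - w ^ a / w ^ b) * (\<Sum>z\<in>unity_roots N. z ^ a / z ^ b) = 0"
    unfolding left_diff_distrib by simp
  then show ?thesis using ne by (metis mult_eq_0_iff right_minus_eq)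
qed

text \<open>
  Expand \<open>ln (1 - w)\<close> in powers of \<open>w\<close> and sum over the points: the first \<open>j\<close> power sums vanish,
  and the remaining ones contribute at most \<open>(d j + 1) / 2 ^ j\<close>.
\<close>

lemma prod_one_minus_tendsto_1:
  fixes w :: "nat \<Rightarrow> 'b \<Rightarrow> complex"
  assumes fin: "\<And>j. finite (U j)"
    and card: "\<And>j. card (U j) = d * j + 1"
    and small: "\<And>j z. z \<in> U j \<Longrightarrow> norm (w j z) \<le> 1 / 2"
    and power_sums: "\<And>j m. 0 < m \<Longrightarrow> m \<le> j \<Longrightarrow> (\<Sum>z\<in>U j. w j z ^ m) = 0"
  shows "(\<lambda>j. \<Prod>z\<in>U j. 1 - w j z) \<longlonglongrightarrow> 1"
proof -
  define E where "E j = (\<Sum>z\<in>U j. ln (1 - w j z))" for j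
  have prod: "(\<Prod>z\<in>U j. 1 - w j z) = exp (E j)" for j
    unfolding E_def exp_sum[OF fin]
  proof (rule prod.cong[OF refl])
    fix z assume "z \<in> U j"
    then have "norm (w j z) < 1" using small[of z j] by simp
    then have "1 - w j z \<noteq> 0" by auto
    then show "1 - w j z = exp (ln (1 - w j z))" by simp
  qed
  have bound: "norm (E j) \<le> real (d * j + 1) * (1 / 2) ^ j" for j
  proof -
    have ser: "(\<lambda>m. - ((w j z) ^ m) / of_nat m) sums ln (1 - w j z)" if "z \<in> U j" for z
      using Ln_series'[of "- w j z"] small[OF that] by simp
    have "(\<lambda>m. \<Sum>z\<in>U j. - ((w j z) ^ m) / of_nat m) sums E j"
      unfolding E_def by (rule sums_sum[OF ser])
    then have S: "(\<lambda>m. - (\<Sum>z\<in>U j. (w j z) ^ m) / of_nat m) sums E j"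
      by (simp add: sum_negf sum_divide_distrib)
    have zero: "- (\<Sum>z\<in>U j. (w j z) ^ m) / of_nat m = 0" if "m < Suc j" for m
      using power_sums[of m j] that by (cases "m = 0") auto
    have "(\<Sum>m<Suc j. - (\<Sum>z\<in>U j. (w j z) ^ m) / of_nat m) = 0"
      by (rule sum.neutral, rule ballI, rule zero) simp
    from sums_split_initial_segment[OF S, of "Suc j", unfolded this diff_0_right]
    have S': "(\<lambda>m. - (\<Sum>z\<in>U j. (w j z) ^ (m + Suc j)) / of_nat (m + Suc j)) sums E j" .
    have geo: "(\<lambda>m. real (d * j + 1) * (1 / 2) ^ Suc j * (1 / 2) ^ m) sums (real (d * j + 1) * (1 / 2) ^ Suc j * 2)"
      using sums_mult[OF geometric_sums[of "1/2 :: real"], of "real (d * j + 1) * (1 / 2) ^ Suc j"] by simp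
    have "norm (E j) \<le> real (d * j + 1) * (1 / 2) ^ Suc j * 2"
    proof (rule norm_sums_le[OF S' geo])
      fix m
      have "norm (\<Sum>z\<in>U j. (w j z) ^ (m + Suc j)) \<le> (\<Sum>z\<in>U j. (1 / 2) ^ (m + Suc j))"
        by (rule sum_norm_le) (use small in \<open>unfold norm_power, blast intro: power_mono norm_ge_zero\<close>)
      also have "\<dots> = real (d * j + 1) * (1 / 2) ^ Suc j * (1 / 2) ^ m"
        by (simp add: card power_add mult_ac)
      finally have *: "norm (\<Sum>z\<in>U j. (w j z) ^ (m + Suc j)) \<le> \<dots>" .
      have "norm (- (\<Sum>z\<in>U j. (w j z) ^ (m + Suc j)) / of_nat (m + Suc j))
          \<le> norm (\<Sum>z\<in>U j. (w j z) ^ (m + Suc j)) / 1"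
        unfolding norm_divide norm_minus_cancel norm_of_nat by (rule divide_left_mono) auto
      with * show "norm (- (\<Sum>z\<in>U j. (w j z) ^ (m + Suc j)) / of_nat (m + Suc j))
          \<le> real (d * j + 1) * (1 / 2) ^ Suc j * (1 / 2) ^ m" by simp
    qed
    then show ?thesis by simp
  qed
  have "(\<lambda>j. real d * (real j * (1 / 2) ^ j) + (1 / 2) ^ j) \<longlonglongrightarrow> real d * 0 + 0"
    by (intro tendsto_intros powser_times_n_limit_0 LIMSEQ_power_zero) auto
  then have "(\<lambda>j. real (d * j + 1) * (1 / 2) ^ j) \<longlonglongrightarrow> 0"
    by (simp add: algebra_simps)
  then have "E \<longlonglongrightarrow> 0"
    by (rule Lim_null_comparison[rotated]) (use bound in simp)
  then have "(\<lambda>j. exp (E j)) \<longlonglongrightarrow> exp 0" by (rule tendsto_exp)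
  then show ?thesis by (simp add: prod)
qed

lemma prod_list_one_minus_powers_tendsto_1:
  fixes xs :: "complex list"
  assumes "\<forall>x\<in>set xs. norm x < 1" "filterlim e at_top sequentially"
  shows "(\<lambda>j. \<Prod>x\<leftarrow>xs. 1 - x ^ e j) \<longlonglongrightarrow> 1"
  using assms(1)
proof (induction xs)
  case (Cons x xs)
  have "(\<lambda>j. x ^ e j) \<longlonglongrightarrow> 0"
    using filterlim_compose[OF LIMSEQ_power_zero[of x] assms(2)] Cons.prems by simp
  then have "(\<lambda>j. (1 - x ^ e j) * (\<Prod>x\<leftarrow>xs. 1 - x ^ e j)) \<longlonglongrightarrow> (1 - 0) * 1"
    using Cons by (intro tendsto_intros) auto
  then show ?case by simp
qed simp

lemma eq_1_if_odd_powers_tendsto_1: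
  fixes K :: complex
  assumes "(\<lambda>j. K ^ (d * j + 1)) \<longlonglongrightarrow> 1"
  shows "K = 1"
proof -
  have "(\<lambda>j. K ^ (d * Suc j + 1)) \<longlonglongrightarrow> 1"
    using assms by (rule LIMSEQ_Suc)
  moreover have "(\<lambda>j. K ^ d * K ^ (d * j + 1)) \<longlonglongrightarrow> K ^ d * 1"
    using assms by (intro tendsto_intros)
  moreover have "K ^ (d * Suc j + 1) = K ^ d * K ^ (d * j + 1)" for j
    by (simp add: power_add mult_ac)
  ultimately have Kd: "K ^ d = 1"
    using LIMSEQ_unique[of "\<lambda>j. K ^ (d * Suc j + 1)" 1 "K ^ d"] by (simp only:) simp
  have "(\<lambda>j. K ^ (d * j + 1)) = (\<lambda>j. K)"
    using Kd by (simp add: power_mult)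
  then show ?thesis using assms LIMSEQ_unique[OF assms, of K] by simp
qed

text \<open>
  Averaging the Laurent polynomial \<open>(q(z) / z ^ u) ^ m\<close> over the \<open>N\<close>-th roots of unity extracts its
  constant term, as soon as \<open>N\<close> exceeds the range of its exponents.
\<close>

lemma sum_unity_roots_poly_power:
  fixes q :: "complex poly"
  assumes "u \<le> degree q" "m * degree q < N"
  shows "(\<Sum>z\<in>unity_roots N. (poly q z / z ^ u) ^ m) = of_nat N * coeff (q ^ m) (u * m)"
proof -
  let ?n = "m * degree q"
  have N: "N > 0" using assms by simp
  have um: "u * m \<le> ?n" using assms(1) by (simp add: mult.commute)
  have deg: "degree (q ^ m) \<le> ?n" using degree_power_le[of q m] by (simp add: mult.commute)
  have pm: "poly q z ^ m = (\<Sum>i\<le>?n. coeff (q ^ m) i * z ^ i)" for z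
    unfolding poly_power[symmetric] poly_altdef[of "q ^ m"]
    using deg by (intro sum.mono_neutral_left) (auto simp: coeff_eq_0)
  have "(\<Sum>z\<in>unity_roots N. (poly q z / z ^ u) ^ m) = (\<Sum>z\<in>unity_roots N. \<Sum>i\<le>?n. coeff (q ^ m) i * (z ^ i / z ^ (u * m)))"
    by (rule sum.cong[OF refl])
      (simp add: power_divide pm sum_divide_distrib power_mult)
  also have "\<dots> = (\<Sum>i\<le>?n. coeff (q ^ m) i * (\<Sum>z\<in>unity_roots N. z ^ i / z ^ (u * m)))"
    by (subst sum.swap) (simp add: sum_distrib_left)
  also have "\<dots> = (\<Sum>i\<le>?n. if i = u * m then coeff (q ^ m) i * of_nat N else 0)"
  proof (rule sum.cong[OF refl])
    fix i assume i: "i \<in> {..?n}"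
    have "(\<Sum>z\<in>unity_roots N. z ^ (u * m) / z ^ (u * m)) = (\<Sum>z\<in>unity_roots N. 1 :: complex)"
      by (rule sum.cong) (use N in \<open>auto simp: power_0_left\<close>)
    also have "\<dots> = of_nat N" using card_roots_unity_eq[OF N] by simp
    finally show "coeff (q ^ m) i * (\<Sum>z\<in>unity_roots N. z ^ i / z ^ (u * m)) =
        (if i = u * m then coeff (q ^ m) i * of_nat N else 0)"
      using sum_unity_roots_power_quotient[of i N "u * m"] i um assms(2) by auto
  qed
  also have "\<dots> = of_nat N * coeff (q ^ m) (u * m)" using um by simp
  finally show ?thesis .
qed

lemma prod_prod_list_swap: "(\<Prod>z\<in>A. \<Prod>a\<leftarrow>xs. f z a) = (\<Prod>a\<leftarrow>xs. \<Prod>z\<in>A. f z a)"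
  for f :: "'a \<Rightarrow> 'b \<Rightarrow> 'c::comm_monoid_mult"
  by (induction xs) (auto simp: prod.distrib)

lemma prod_list_filter_split:
  fixes f :: "'a \<Rightarrow> 'b::comm_monoid_mult"
  shows "(\<Prod>a\<leftarrow>xs. f a) = (\<Prod>a\<leftarrow>filter P xs. f a) * (\<Prod>a\<leftarrow>filter (\<lambda>a. \<not> P a) xs. f a)"
  by (induction xs) (auto simp: mult_ac)

text \<open>
  This is where vanishing constant terms are used.  Split the roots of \<open>F(x) = s x ^ u - q(x)\<close> at the
  unit circle, on which \<open>F\<close> has no zero because \<open>s\<close> is large, and write
  \[ 1 - \frac{q(x)}{s x ^ u} = \frac{K}{x ^ u} \prod_{|a|<1} (x - a) \prod_{|b|>1} (1 - x / b). \]
  Multiply over the \<open>N\<close>-th roots of unity for odd \<open>N\<close>.  The left-hand side tends to 1, since the power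
  sums of \<open>q(z) / (s z ^ u)\<close> are constant terms of powers and vanish.  The products over \<open>a\<close> and \<open>b\<close>
  become \<open>1 - a ^ N\<close> and \<open>1 - b ^ (-N)\<close>, which tend to 1 too.  So \<open>K ^ N\<close> tends to 1 along an
  arithmetic progression of odd \<open>N\<close>, which forces \<open>K = 1\<close>, and comparing constant coefficients of \<open>F\<close>
  gives the product of the small roots.
\<close>

lemma small_roots_product:
  fixes q :: "complex poly"
  assumes u: "0 < u" "u < degree q"
    and vanish: "\<And>m. m > 0 \<Longrightarrow> coeff (q ^ m) (u * m) = 0"
    and s: "norm s \<ge> 2 * (\<Sum>i\<le>degree q. norm (coeff q i))" "s \<noteq> 0"
  obtains as where "\<And>a. a \<in> set as \<Longrightarrow> poly q a = s * a ^ u" "length as \<le> degree q"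
    "s * (\<Prod>a\<leftarrow>as. - a) = - coeff q 0"
proof -
  define n where "n = degree q"
  define F where "F = monom s u - q"
  have degF: "degree F = n" "lead_coeff F = - lead_coeff q"
  proof -
    have d: "degree (monom s u) < degree q"
      using u degree_monom_le[of s u] by linarith
    then show "degree F = n"
      unfolding F_def n_def using degree_add_eq_right[of "monom s u" "- q"] by simp
    then show "lead_coeff F = - lead_coeff q" using u by (simp add: F_def n_def)
  qed
  define c where "c = - lead_coeff q"
  obtain as where as: "Polynomial.smult c (\<Prod>a\<leftarrow>as. [:- a, 1:]) = F" and len: "length as = n"
    using fundamental_theorem_algebra_factorized[of F] degF unfolding c_def by auto
  have F: "poly F x = c * (\<Prod>a\<leftarrow>as. x - a)" for x
    unfolding as[symmetric] by (simp add: poly_prod_list o_def)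
  have c0: "c \<noteq> 0" using u by (auto simp: c_def)
  have qb: "norm (poly q x) \<le> norm s / 2" if "norm x = 1" for x
  proof -
    have "norm (poly q x) \<le> (\<Sum>i\<le>degree q. norm (coeff q i * x ^ i))"
      unfolding poly_altdef by (rule norm_sum)
    also have "\<dots> = (\<Sum>i\<le>degree q. norm (coeff q i))"
      using that by (simp add: norm_mult norm_power)
    finally show ?thesis using s by linarith
  qed
  have no_root: "poly F x \<noteq> 0" if "norm x = 1" for x
  proof
    assume "poly F x = 0"
    then have "norm (poly q x) = norm s" using that
      by (simp add: F_def poly_monom norm_mult norm_power flip: eq_iff_diff_eq_0)
        (metis norm_mult norm_power mult.right_neutral power_one)
    then show False using qb[OF that] s(2) by simp
  qed
  have root: "poly F a = 0" if "a \<in> set as" for a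
    using that unfolding F by (auto simp: prod_list_zero_iff)
  define S where "S = filter (\<lambda>a. norm a < 1) as"
  define B where "B = filter (\<lambda>a. \<not> norm a < 1) as"
  have B1: "norm b > 1" if "b \<in> set B" for b
    using that no_root[of b] root[of b] by (force simp: B_def)
  have B0: "b \<noteq> 0" if "b \<in> set B" for b using B1[OF that] by auto
  define K where "K = c * (\<Prod>b\<leftarrow>B. - b) / s"
  have F2: "poly F x = s * K * (\<Prod>a\<leftarrow>S. x - a) * (\<Prod>b\<leftarrow>B. 1 - x / b)" for x
  proof -
    have "(\<Prod>b\<leftarrow>B. x - b) = (\<Prod>b\<leftarrow>B. - b) * (\<Prod>b\<leftarrow>B. 1 - x / b)"
      using B0 by (induction B) (auto simp: field_simps)
    then show ?thesis
      unfolding F prod_list_filter_split[of "\<lambda>a. x - a" as "\<lambda>a. norm a < 1"] S_def[symmetric] B_def[symmetric]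
      using s(2) by (simp add: K_def)
  qed
  \<comment> \<open>These \<open>N j\<close> are odd, and exceed the degree of \<open>q ^ m\<close> for all \<open>m \<le> j\<close>.\<close>
  define d where "d = 2 * n"
  define N where "N j = d * j + 1" for j
  have N: "N j > 0" "odd (N j)" for j by (auto simp: N_def d_def)
  define w where "w z = poly q z / (s * z ^ u)" for z
  have unit: "norm z = 1" if "z \<in> unity_roots (N j)" for z j
  proof -
    have "norm z ^ N j = 1" using that by (simp flip: norm_power)
    then show ?thesis using N(1)[of j] power_inject_base[of "norm z" "N j - 1" 1] by simp
  qed
  have lim: "(\<lambda>j. \<Prod>z\<in>unity_roots (N j). 1 - w z) \<longlonglongrightarrow> 1"
  proof (rule prod_one_minus_tendsto_1[where d = d])
    show "finite (unity_roots (N j))" for j using N(1)[of j] finite_roots_unity[of "N j"] by simp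
    show "card (unity_roots (N j)) = d * j + 1" for j
      using card_roots_unity_eq[OF N(1)] by (simp add: N_def)
    show "norm (w z) \<le> 1 / 2" if "z \<in> unity_roots (N j)" for j z
      using qb[OF unit[OF that]] unit[OF that] s(2)
      by (simp add: w_def norm_divide norm_mult norm_power field_simps)
    show "(\<Sum>z\<in>unity_roots (N j). w z ^ m) = 0" if "0 < m" "m \<le> j" for j m
    proof -
      have "m * n \<le> j * n" using that(2) by (rule mult_right_mono) simp
      also have "\<dots> \<le> 2 * n * j" by simp
      finally have "m * n < N j" unfolding N_def d_def by linarith
      then have "(\<Sum>z\<in>unity_roots (N j). (poly q z / z ^ u) ^ m) = 0"
        using sum_unity_roots_poly_power[of u q m "N j"] vanish[OF that(1)] u by (simp add: n_def)
      moreover have "(\<Sum>z\<in>unity_roots (N j). w z ^ m) = (\<Sum>z\<in>unity_roots (N j). (poly q z / z ^ u) ^ m) / s ^ m"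
        unfolding sum_divide_distrib
        by (rule sum.cong) (auto simp: w_def power_divide power_mult_distrib)
      ultimately show ?thesis by simp
    qed
  qed
  have prod_eq: "(\<Prod>z\<in>unity_roots (N j). 1 - w z) = K ^ N j * (\<Prod>a\<leftarrow>S @ map inverse B. 1 - a ^ N j)" for j
  proof -
    let ?U = "unity_roots (N j)"
    have card: "card ?U = N j" using card_roots_unity_eq[OF N(1)] by simp
    have neg: "(\<Prod>z\<in>?U. z - a) = 1 - a ^ N j" for a
    proof -
      have "(\<Prod>z\<in>?U. z - a) = (\<Prod>z\<in>?U. - 1 * (a - z))" by simp
      also have "\<dots> = (- 1) ^ N j * (a ^ N j - 1)"
        unfolding prod.distrib prod_diff_unity_roots[OF N(1)] by (simp add: card)
      finally show ?thesis using N(2) by simp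
    qed
    have "(\<Prod>z\<in>?U. z) = 1" using neg[of 0] N(1)[of j] by (simp add: power_0_left)
    then have zu: "(\<Prod>z\<in>?U. z ^ u) = 1" by (simp add: prod_power_distrib[symmetric])
    have quot: "(\<Prod>z\<in>?U. 1 - z / b) = 1 - inverse b ^ N j" if "b \<in> set B" for b
    proof -
      have "(\<Prod>z\<in>?U. 1 - z / b) = (\<Prod>z\<in>?U. (b - z) / b)"
        using B0[OF that] by (simp add: diff_divide_distrib)
      also have "\<dots> = (b ^ N j - 1) / b ^ N j"
        unfolding prod_dividef prod_diff_unity_roots[OF N(1)] by (simp add: card)
      finally show ?thesis using B0[OF that] by (simp add: field_simps)
    qed
    have "s ^ N j * (\<Prod>z\<in>?U. 1 - w z) = (\<Prod>z\<in>?U. z ^ u) * (s ^ N j * (\<Prod>z\<in>?U. 1 - w z))"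
      using zu by simp
    also have "\<dots> = (\<Prod>z\<in>?U. z ^ u * (s * (1 - w z)))"
      by (simp add: prod.distrib card)
    also have "\<dots> = (\<Prod>z\<in>?U. poly F z)"
    proof (rule prod.cong[OF refl])
      fix z assume "z \<in> ?U"
      then have "z \<noteq> 0" using unit by force
      then show "z ^ u * (s * (1 - w z)) = poly F z"
        using s(2) by (simp add: F_def w_def poly_monom field_simps)
    qed
    also have "\<dots> = s ^ N j * K ^ N j * (\<Prod>a\<leftarrow>S. 1 - a ^ N j) * (\<Prod>b\<leftarrow>B. 1 - inverse b ^ N j)"
      unfolding F2 prod.distrib prod_prod_list_swap neg using quot
      by (simp add: card cong: map_cong)
    finally show ?thesis using s(2) by (simp add: o_def)
  qed
  have "filterlim N at_top sequentially"
    unfolding N_def d_def filterlim_at_top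
  proof (intro allI)
    fix Z
    show "\<forall>\<^sub>F j in sequentially. Z \<le> 2 * n * j + 1"
      unfolding eventually_sequentially
    proof (intro exI[of _ Z] allI impI)
      fix j assume "Z \<le> j"
      moreover have "1 * j \<le> 2 * n * j" using u by (intro mult_right_mono) (auto simp: n_def)
      ultimately show "Z \<le> 2 * n * j + 1" by linarith
    qed
  qed
  then have lim2: "(\<lambda>j. \<Prod>a\<leftarrow>S @ map inverse B. 1 - a ^ N j) \<longlonglongrightarrow> 1"
  proof (rule prod_list_one_minus_powers_tendsto_1[rotated])
    show "\<forall>x\<in>set (S @ map inverse B). norm x < 1"
      using B1 by (auto simp: S_def norm_inverse inverse_less_1_iff)
  qed
  have "(\<lambda>j. (\<Prod>z\<in>unity_roots (N j). 1 - w z) / (\<Prod>a\<leftarrow>S @ map inverse B. 1 - a ^ N j)) \<longlonglongrightarrow> 1 / 1"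
    by (intro tendsto_intros lim lim2) simp
  moreover have "\<forall>\<^sub>F j in sequentially. (\<Prod>z\<in>unity_roots (N j). 1 - w z) / (\<Prod>a\<leftarrow>S @ map inverse B. 1 - a ^ N j) = K ^ N j"
    using tendsto_imp_eventually_ne[OF lim2 zero_neq_one[symmetric]]
    by (rule eventually_mono) (simp add: prod_eq)
  ultimately have "(\<lambda>j. K ^ N j) \<longlonglongrightarrow> 1"
    by (simp add: tendsto_cong)
  then have "K = 1" unfolding N_def by (rule eq_1_if_odd_powers_tendsto_1)
  show thesis
  proof (rule that[of S])
    show "poly q a = s * a ^ u" if "a \<in> set S" for a
      using root[of a] that by (simp add: S_def F_def poly_monom)
    show "length S \<le> degree q"
      using len length_filter_le[of "\<lambda>a. norm a < 1" as] by (simp add: S_def n_def)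
    have "poly F 0 = s * (\<Prod>a\<leftarrow>S. - a)" using F2[of 0] \<open>K = 1\<close> by (simp add: o_def map_replicate_const)
    then show "s * (\<Prod>a\<leftarrow>S. - a) = - coeff q 0"
      using u by (simp add: F_def poly_monom poly_0_coeff_0)
  qed
qed

text \<open>
  The value 1 is admitted so that a list of roots whose length depends on \<open>s\<close> can be padded to a fixed
  length.  The roots are integral because \<open>q(x) - s x ^ u\<close> has the constant leading coefficient of \<open>q\<close>.
\<close>

lemma integral_on_root_or_1:
  fixes q :: "complex poly"
  assumes u: "u < degree q"
    and y: "\<And>s. s \<in> T \<Longrightarrow> poly q (y s) = s * y s ^ u \<or> y s = 1"
  shows "integral_on T y"
proof -
  define c where "c = inverse (lead_coeff q)"
  define Q where "Q = map_poly (\<lambda>a. [:c * a:]) q - monom [:0, c:] u"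
  have c0: "c \<noteq> 0" "c * lead_coeff q = 1"
    using u leading_coeff_0_iff[of q] by (auto simp: c_def simp del: leading_coeff_0_iff)
  have dq: "degree (map_poly (\<lambda>a. [:c * a:]) q) = degree q"
    by (rule degree_map_poly) (use c0 in auto)
  have d: "degree (monom [:0, c:] u) < degree (map_poly (\<lambda>a. [:c * a:]) q)"
    unfolding dq using degree_monom_le u by (rule le_less_trans)
  have dQ: "degree Q = degree q"
    unfolding Q_def using degree_add_eq_right[of "- monom [:0, c:] u" "map_poly (\<lambda>a. [:c * a:]) q"] d dq
    by simp
  have lQ: "lead_coeff Q = 1"
    unfolding dQ using u c0 by (simp add: Q_def coeff_map_poly)
  have Q: "poly (poly Q [:x:]) s = c * (poly q x - s * x ^ u)" for x s
  proof -
    have "poly (map_poly (\<lambda>a. [:c * a:]) q) [:x:] = [:c * poly q x:]"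
    proof (induction q)
      case (pCons a p)
      have "map_poly (\<lambda>a. [:c * a:]) (pCons a p) = pCons [:c * a:] (map_poly (\<lambda>a. [:c * a:]) p)"
        using pCons.hyps by (auto simp: map_poly_pCons)
      then show ?case using pCons.IH by (simp add: algebra_simps)
    qed simp
    moreover have "[:x:] ^ u = [:x ^ u:]" by (induction u) auto
    ultimately show ?thesis by (simp add: Q_def poly_monom algebra_simps)
  qed
  have "lead_coeff (Q * [:-1, 1:]) = 1" unfolding lead_coeff_mult lQ by simp
  moreover have "poly (poly (Q * [:-1, 1:]) [:y s:]) s = 0" if "s \<in> T" for s
    using y[OF that] by (auto simp: Q)
  ultimately show ?thesis unfolding integral_on_def by blast
qed

text \<open>
  The one-variable case of the theorem of Duistermaat and van der Kallen: if \<open>0\<close> lies between the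
  lowest and the highest exponent of the Laurent polynomial \<open>q(x) / x ^ u\<close>, then some power of it has a
  nonzero constant term.  Otherwise, for all large \<open>s\<close>, a product of roots of \<open>s x ^ u = q(x)\<close> would
  equal \<open>q(0) / s\<close> up to sign.  But such a product is integral over \<open>\<complex>[s]\<close>.
\<close>

theorem constant_term_power_nonzero:
  fixes q :: "complex poly"
  assumes "coeff q 0 \<noteq> 0" "u \<le> degree q"
  shows "\<exists>m>0. coeff (q ^ m) (u * m) \<noteq> 0"
proof (cases "u = 0 \<or> u = degree q")
  case True
  have "coeff q (u * 1) \<noteq> 0" using True assms by auto
  then show ?thesis by (intro exI[of _ 1]) simp
next
  case False
  then have u: "0 < u" "u < degree q" using assms by auto
  show ?thesis
  proof (rule ccontr)
    assume "\<not> ?thesis"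
    then have vanish: "coeff (q ^ m) (u * m) = 0" if "m > 0" for m using that by blast
    define C where "C = 1 + 2 * (\<Sum>i\<le>degree q. norm (coeff q i))"
    define T where "T = {s :: complex. norm s \<ge> C}"
    have C: "C \<ge> 1" unfolding C_def by (simp add: sum_nonneg)
    have inf: "infinite T"
    proof
      assume "finite T"
      moreover have "(\<lambda>n. of_real (C + real n)) ` UNIV \<subseteq> T"
        using C by (auto simp: T_def simp flip: of_real_add)
      moreover have "inj (\<lambda>n. complex_of_real (C + real n))"
        by (auto simp: inj_on_def simp del: of_real_add)
      ultimately show False using finite_subset finite_imageD infinite_UNIV_nat by blast
    qed
    have "\<exists>as. (\<forall>a\<in>set as. poly q a = s * a ^ u) \<and> length as \<le> degree q \<and>
        s * (\<Prod>a\<leftarrow>as. - a) = - coeff q 0" if "s \<in> T" for s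
    proof -
      have "2 * (\<Sum>i\<le>degree q. norm (coeff q i)) \<le> norm s" "s \<noteq> 0"
        using that C by (auto simp: T_def C_def)
      from small_roots_product[OF u vanish this] show ?thesis by metis
    qed
    then obtain as where as: "\<And>s a. s \<in> T \<Longrightarrow> a \<in> set (as s) \<Longrightarrow> poly q a = s * a ^ u"
      "\<And>s. s \<in> T \<Longrightarrow> length (as s) \<le> degree q"
      "\<And>s. s \<in> T \<Longrightarrow> s * (\<Prod>a\<leftarrow>as s. - a) = - coeff q 0"
      by metis
    define y where "y i s = (if i < length (as s) then as s ! i else 1)" for i s
    have "integral_on T (y i)" for i
      by (rule integral_on_root_or_1[OF u(2)]) (use as(1) in \<open>auto simp: y_def\<close>)
    then have y: "integral_on T (\<lambda>s. \<Prod>i<degree q. y i s)" by (intro integral_on_prod)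
    define Y where "Y s = (\<Prod>i<degree q. y i s)" for s
    have Y: "Y s = (\<Prod>a\<leftarrow>as s. a)" if "s \<in> T" for s
    proof -
      have "Y s = (\<Prod>i<length (as s). y i s)"
        unfolding Y_def by (rule prod.mono_neutral_right) (use as(2)[OF that] in \<open>auto simp: y_def\<close>)
      also have "\<dots> = (\<Prod>i<length (as s). as s ! i)"
        by (rule prod.cong) (auto simp: y_def)
      also have "\<dots> = (\<Prod>a\<leftarrow>as s. a)" by (simp add: prod.list_conv_set_nth atLeast0LessThan)
      finally show ?thesis .
    qed
    have neg: "(\<Prod>a\<leftarrow>xs. - a) = (- 1) ^ length xs * prod_list xs" for xs :: "complex list"
      by (induction xs) auto
    \<comment> \<open>Squaring removes the sign, which depends on how many roots are small.\<close>
    have "s ^ 2 * (Y s * Y s) = (coeff q 0) ^ 2" if "s \<in> T" for s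
    proof -
      have "(coeff q 0) ^ 2 = (s * (\<Prod>a\<leftarrow>as s. - a)) ^ 2" using as(3)[OF that] by simp
      also have "\<dots> = s ^ 2 * (Y s * Y s)"
        unfolding neg Y[OF that] by (simp add: power_mult_distrib power2_eq_square flip: power_mult_distrib)
      finally show ?thesis by simp
    qed
    moreover have "integral_on T (\<lambda>s. Y s * Y s)"
      using integral_on_mult[OF y y] unfolding Y_def .
    ultimately show False
      using not_integral_on_inverse_power[OF inf, of "\<lambda>s. Y s * Y s" "(coeff q 0) ^ 2" 2] assms(1) by auto
  qed
qed

section \<open>Primes inverted in finitely generated subrings of the complex numbers\<close>

definition is_subring :: "complex set \<Rightarrow> bool" where
  "is_subring R \<longleftrightarrow> 1 \<in> R \<and> (\<forall>x\<in>R. - x \<in> R) \<and> (\<forall>x\<in>R. \<forall>y\<in>R. x + y \<in> R \<and> x * y \<in> R)"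

text \<open>
  The condition says that a prime \<open>p\<close> becomes invertible in the localization \<open>R[1/g]\<close>, equivalently
  that \<open>g\<close> is nilpotent modulo \<open>p R\<close>.
\<close>

definition few_inverted_primes :: "complex set \<Rightarrow> bool" where
  "few_inverted_primes R \<longleftrightarrow>
     (\<forall>g\<in>R. g \<noteq> 0 \<longrightarrow> finite {p::nat. prime p \<and> (\<exists>M. \<exists>h\<in>R. g ^ M = of_nat p * h)})"

definition polys_over :: "complex set \<Rightarrow> complex poly set" where
  "polys_over R = {P. \<forall>i. coeff P i \<in> R}"

definition adjoin :: "complex set \<Rightarrow> complex \<Rightarrow> complex set" where
  "adjoin R c = (\<lambda>P. poly P c) ` polys_over R"

context
  fixes R :: "complex set"
  assumes R: "is_subring R"
begin

lemma subring_closed: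
  shows "1 \<in> R" "0 \<in> R" "x \<in> R \<Longrightarrow> - x \<in> R" "x \<in> R \<Longrightarrow> y \<in> R \<Longrightarrow> x + y \<in> R"
    "x \<in> R \<Longrightarrow> y \<in> R \<Longrightarrow> x * y \<in> R" "x \<in> R \<Longrightarrow> y \<in> R \<Longrightarrow> x - y \<in> R"
proof -
  have *: "1 + - 1 \<in> R" using R unfolding is_subring_def by blast
  show "1 \<in> R" "0 \<in> R" "x \<in> R \<Longrightarrow> - x \<in> R" "x \<in> R \<Longrightarrow> y \<in> R \<Longrightarrow> x + y \<in> R"
    "x \<in> R \<Longrightarrow> y \<in> R \<Longrightarrow> x * y \<in> R"
    using R * by (auto simp: is_subring_def)
  show "x \<in> R \<Longrightarrow> y \<in> R \<Longrightarrow> x - y \<in> R"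
    using R unfolding is_subring_def by (metis diff_conv_add_uminus)
qed

lemma subring_sum: "(\<And>i. i \<in> A \<Longrightarrow> f i \<in> R) \<Longrightarrow> sum f A \<in> R"
  by (induction A rule: infinite_finite_induct) (auto intro: subring_closed)

lemma subring_power: "x \<in> R \<Longrightarrow> x ^ k \<in> R"
  by (induction k) (auto intro: subring_closed)

lemma subring_of_nat: "of_nat k \<in> R"
  by (induction k) (auto intro: subring_closed)

lemma polys_over_closed:
  assumes "P \<in> polys_over R" "Q \<in> polys_over R"
  shows "P + Q \<in> polys_over R" "P - Q \<in> polys_over R" "P * Q \<in> polys_over R"
  using assms by (auto simp: polys_over_def coeff_mult intro!: subring_closed subring_sum)

lemma polys_over_smult: "a \<in> R \<Longrightarrow> P \<in> polys_over R \<Longrightarrow> Polynomial.smult a P \<in> polys_over R"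
  by (auto simp: polys_over_def intro: subring_closed)

lemma polys_over_monom: "a \<in> R \<Longrightarrow> monom a k \<in> polys_over R"
  by (auto simp: polys_over_def intro: subring_closed)

lemma polys_over_const: "a \<in> R \<Longrightarrow> [:a:] \<in> polys_over R"
  using polys_over_monom[of a 0] by (simp add: monom_0)

lemma adjoinI: "P \<in> polys_over R \<Longrightarrow> poly P c \<in> adjoin R c"
  by (auto simp: adjoin_def)

lemma is_subring_adjoin: "is_subring (adjoin R c)"
  unfolding is_subring_def
proof (intro conjI ballI)
  show "1 \<in> adjoin R c" using adjoinI[OF polys_over_const[OF subring_closed(1)]] by simp
  fix x assume "x \<in> adjoin R c"
  then obtain P where P: "P \<in> polys_over R" "x = poly P c" by (auto simp: adjoin_def)
  have "Polynomial.smult (- 1) P \<in> polys_over R"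
    by (intro polys_over_smult subring_closed P)
  from adjoinI[OF this] show "- x \<in> adjoin R c" using P by simp
  fix y assume "y \<in> adjoin R c"
  then obtain Q where Q: "Q \<in> polys_over R" "y = poly Q c" by (auto simp: adjoin_def)
  show "x + y \<in> adjoin R c" "x * y \<in> adjoin R c"
    using adjoinI[OF polys_over_closed(1)[OF P(1) Q(1)]] adjoinI[OF polys_over_closed(3)[OF P(1) Q(1)]] P Q
    by auto
qed

lemma subset_adjoin: "R \<subseteq> adjoin R c"
  using adjoinI[OF polys_over_const] by force

lemma mem_adjoin: "c \<in> adjoin R c"
  using adjoinI[OF polys_over_monom[OF subring_closed(1)], of 1 c] by (simp add: poly_monom)

text \<open>
  Division with remainder by \<open>F\<close> is possible over \<open>R\<close> after scaling by a power of the leading coefficient.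
\<close>

lemma pseudo_division_over:
  assumes "F \<in> polys_over R" "G \<in> polys_over R" "F \<noteq> 0"
  obtains k Q B where "Q \<in> polys_over R" "B \<in> polys_over R"
    "Polynomial.smult (lead_coeff F ^ k) G = F * Q + B" "B = 0 \<or> degree B < degree F"
proof -
  let ?w = "lead_coeff F"
  have w: "?w \<in> R" using assms(1) by (simp add: polys_over_def)
  have "\<exists>k Q B. Q \<in> polys_over R \<and> B \<in> polys_over R \<and> Polynomial.smult (?w ^ k) G = F * Q + B
      \<and> (B = 0 \<or> degree B < degree F)"
    using assms(2)
  proof (induction "if G = 0 then 0 else Suc (degree G)" arbitrary: G rule: less_induct)
    case less
    have zero: "0 \<in> polys_over R" using polys_over_const[OF subring_closed(2)] by simp
    show ?case
    proof (cases "G = 0 \<or> degree G < degree F")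
      case True
      then show ?thesis using less.prems zero
        by (intro exI[of _ 0] exI[of _ 0] exI[of _ G]) auto
    next
      case False
      let ?T = "monom (lead_coeff G) (degree G - degree F)"
      define G' where "G' = Polynomial.smult ?w G - F * ?T"
      have T: "?T \<in> polys_over R"
        using less.prems by (intro polys_over_monom) (simp add: polys_over_def)
      have G': "G' \<in> polys_over R"
        unfolding G'_def by (intro polys_over_closed polys_over_smult w less.prems assms(1) T)
      have degs: "degree (Polynomial.smult ?w G) = degree G" "degree (F * ?T) = degree G"
        using False assms(3) by (auto simp: degree_mult_eq degree_monom_eq)
      have "coeff (F * ?T) (degree (F * ?T)) = ?w * lead_coeff G"
        unfolding lead_coeff_mult using False by (simp add: degree_monom_eq)
      then have lc: "coeff G' (degree G) = 0"
        unfolding degs G'_def by simp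
      have "degree G' \<le> degree G"
        unfolding G'_def by (intro degree_diff_le) (use degs in auto)
      then have "G' = 0 \<or> degree G' < degree G"
        using lc by (metis le_neq_implies_less leading_coeff_0_iff)
      then have "(if G' = 0 then 0 else Suc (degree G')) < (if G = 0 then 0 else Suc (degree G))"
        using False by auto
      from less.hyps[OF this G'] obtain k Q B where
        *: "Q \<in> polys_over R" "B \<in> polys_over R" "Polynomial.smult (?w ^ k) G' = F * Q + B"
          "B = 0 \<or> degree B < degree F" by blast
      have "Polynomial.smult (?w ^ Suc k) G = F * (Q + Polynomial.smult (?w ^ k) ?T) + B"
        using *(3) by (simp add: G'_def smult_diff_right algebra_simps)
      moreover have "Q + Polynomial.smult (?w ^ k) ?T \<in> polys_over R"
        by (intro polys_over_closed polys_over_smult subring_power w T *)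
      ultimately show ?thesis using * by blast
    qed
  qed
  then show thesis using that by blast
qed

text \<open>
  When \<open>c\<close> is transcendental over \<open>R\<close>, a relation \<open>g ^ M = p * h\<close> in \<open>R[c]\<close> is an identity of
  polynomials, and its leading coefficients give a relation of the same kind in \<open>R\<close>.
\<close>

lemma few_inverted_primes_adjoin_transcendental:
  assumes few: "few_inverted_primes R"
    and tr: "\<And>P. P \<in> polys_over R \<Longrightarrow> poly P c = 0 \<Longrightarrow> P = 0"
  shows "few_inverted_primes (adjoin R c)"
  unfolding few_inverted_primes_def
proof (intro ballI impI)
  fix g assume "g \<in> adjoin R c" and g0: "g \<noteq> 0"
  then obtain G where G: "G \<in> polys_over R" "g = poly G c" by (auto simp: adjoin_def)
  have lc: "lead_coeff G \<in> R" "lead_coeff G \<noteq> 0" using G g0 by (auto simp: polys_over_def)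
  have pow: "G ^ M \<in> polys_over R" for M
    by (induction M) (use G polys_over_const[OF subring_closed(1)] in \<open>auto intro: polys_over_closed simp: one_pCons\<close>)
  have "{p::nat. prime p \<and> (\<exists>M. \<exists>h\<in>adjoin R c. g ^ M = of_nat p * h)}
      \<subseteq> {p::nat. prime p \<and> (\<exists>M. \<exists>h\<in>R. lead_coeff G ^ M = of_nat p * h)}"
  proof safe
    fix p :: nat and M h assume p: "prime p" and "h \<in> adjoin R c" and eq: "g ^ M = of_nat p * h"
    then obtain H where H: "H \<in> polys_over R" "h = poly H c" by (auto simp: adjoin_def)
    have "G ^ M - Polynomial.smult (of_nat p) H = 0"
      using eq G H by (intro tr polys_over_closed polys_over_smult pow subring_of_nat) auto
    then have "coeff (G ^ M) (degree (G ^ M)) = of_nat p * coeff H (degree (G ^ M))"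
      by (metis coeff_smult eq_iff_diff_eq_0)
    then have "lead_coeff G ^ M = of_nat p * coeff H (degree (G ^ M))"
      by (simp add: lead_coeff_power)
    then show "\<exists>M. \<exists>h\<in>R. lead_coeff G ^ M = of_nat p * h" using H by (auto simp: polys_over_def)
  qed
  then show "finite {p::nat. prime p \<and> (\<exists>M. \<exists>h\<in>adjoin R c. g ^ M = of_nat p * h)}"
    using few lc unfolding few_inverted_primes_def by (meson finite_subset)
qed

text \<open>
  Let \<open>F\<close> be a relation of minimal degree \<open>n\<close> for \<open>c\<close>, with leading coefficient \<open>w\<close>.  Every nonzero \<open>g\<close>
  in \<open>R[c]\<close> divides a nonzero element \<open>e\<close> of \<open>R\<close>, so it is enough to treat \<open>e ^ M = p * h\<close>.  After
  multiplication by a power of \<open>w\<close>, the element \<open>h\<close> is a combination of \<open>1, c, ..., c ^ (n - 1)\<close>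
  over \<open>R\<close>.  These powers are linearly independent over \<open>R\<close>, and comparing the coefficients of 1
  exhibits \<open>p\<close> as a divisor of a power of \<open>w * e\<close> in \<open>R\<close>.
\<close>

lemma few_inverted_primes_adjoin_algebraic:
  assumes few: "few_inverted_primes R"
    and F: "F \<in> polys_over R" "F \<noteq> 0" "poly F c = 0"
    and min: "\<And>P. P \<in> polys_over R \<Longrightarrow> poly P c = 0 \<Longrightarrow> degree P < degree F \<Longrightarrow> P = 0"
  shows "few_inverted_primes (adjoin R c)"
  unfolding few_inverted_primes_def
proof (intro ballI impI)
  fix g assume g: "g \<in> adjoin R c" and g0: "g \<noteq> 0"
  let ?S = "adjoin R c"
  note S = is_subring_adjoin[of c]
  define w where "w = lead_coeff F"
  have w: "w \<in> R" "w \<noteq> 0" using F by (auto simp: w_def polys_over_def)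
  have n0: "degree F > 0"
  proof (rule ccontr)
    assume "\<not> degree F > 0"
    then obtain a where "F = [:a:]" by (metis degree_eq_zeroE neq0_conv)
    then show False using F by simp
  qed
  \<comment> \<open>Among the polynomials with nonzero value in \<open>g R[c]\<close>, one of least degree is constant: otherwise
     dividing \<open>F\<close> by it leaves a remainder of smaller degree, or a factor of \<open>F\<close> that vanishes at \<open>c\<close>.\<close>
  have "\<exists>e h. e \<in> R \<and> e \<noteq> 0 \<and> h \<in> ?S \<and> e = g * h"
  proof -
    define good where "good G \<longleftrightarrow> G \<in> polys_over R \<and> poly G c \<noteq> 0 \<and> (\<exists>h\<in>?S. poly G c = g * h)" for G
    obtain G0 where "G0 \<in> polys_over R" "g = poly G0 c" using g by (auto simp: adjoin_def)
    then have "good G0" using g0 is_subring_adjoin[of c]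
      by (auto simp: good_def is_subring_def intro!: bexI[of _ 1])
    define G where "G = (ARG_MIN degree G. good G)"
    have G: "good G" unfolding G_def using \<open>good G0\<close> by (rule arg_min_natI)
    have Gmin: "degree G \<le> degree H" if "good H" for H
      unfolding G_def by (rule arg_min_nat_le) (fact that)
    obtain h where h: "h \<in> ?S" "poly G c = g * h" using G by (auto simp: good_def)
    have GR: "G \<in> polys_over R" "G \<noteq> 0" "poly G c \<noteq> 0" using G by (auto simp: good_def)
    have less: "degree G < degree F"
    proof -
      obtain k Q B where B: "Q \<in> polys_over R" "B \<in> polys_over R"
        "Polynomial.smult (lead_coeff F ^ k) G = F * Q + B" "B = 0 \<or> degree B < degree F"
        using pseudo_division_over[OF F(1) GR(1) F(2)] by blast
      have Bc: "poly B c = w ^ k * poly G c"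
        using arg_cong[OF B(3), of "\<lambda>P. poly P c"] F(3) by (simp add: w_def)
      then have "poly B c \<noteq> 0" using w GR by simp
      moreover have "poly B c = g * (w ^ k * h)" using Bc h by simp
      moreover have "w ^ k * h \<in> ?S"
        using subring_power[OF w(1), of k] subset_adjoin[of c] h S unfolding is_subring_def by blast
      ultimately have "good B" using B by (auto simp: good_def)
      then show ?thesis using Gmin[of B] B(4) \<open>poly B c \<noteq> 0\<close> by fastforce
    qed
    have "degree G = 0"
    proof (rule ccontr)
      assume d: "degree G \<noteq> 0"
      obtain k Q B where B: "Q \<in> polys_over R" "B \<in> polys_over R"
        "Polynomial.smult (lead_coeff G ^ k) F = G * Q + B" "B = 0 \<or> degree B < degree G"
        using pseudo_division_over[OF GR(1) F(1) GR(2)] by blast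
      have Bc: "poly B c = g * (- (h * poly Q c))"
        using arg_cong[OF B(3), of "\<lambda>P. poly P c"] F(3) h(2) by (simp add: algebra_simps eq_neg_iff_add_eq_0)
      have "poly B c = 0"
      proof (rule ccontr)
        assume nz: "poly B c \<noteq> 0"
        have "- (h * poly Q c) \<in> ?S"
          using adjoinI[OF B(1)] h S unfolding is_subring_def by blast
        then have "\<exists>h\<in>?S. poly B c = g * h" using Bc by blast
        then have "good B" using B(2) nz by (simp add: good_def)
        then show False using Gmin[of B] B(4) nz by fastforce
      qed
      then have "B = 0" using B(2,4) less by (intro min) auto
      then have FQ: "Polynomial.smult (lead_coeff G ^ k) F = G * Q" using B by simp
      then have "poly G c * poly Q c = 0"
        using F(3) by (metis mult_zero_right poly_mult poly_smult)
      then have "poly Q c = 0" using GR by simp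
      have Q0: "Q \<noteq> 0" using FQ F GR by auto
      have "degree F = degree G + degree Q"
        using arg_cong[OF FQ, of degree] GR Q0 by (simp add: degree_mult_eq)
      then have "Q = 0" using B(1) \<open>poly Q c = 0\<close> d by (intro min) auto
      with Q0 show False ..
    qed
    then obtain a where "G = [:a:]" by (metis degree_eq_zeroE)
    then show ?thesis using GR h by (intro exI[of _ a] exI[of _ h]) (auto simp: polys_over_def split: nat.splits dest: spec[of _ 0])
  qed
  then obtain e h where e: "e \<in> R" "e \<noteq> 0" "h \<in> ?S" "e = g * h" by blast
  have "{p::nat. prime p \<and> (\<exists>M. \<exists>h\<in>?S. g ^ M = of_nat p * h)}
      \<subseteq> {p::nat. prime p \<and> (\<exists>M. \<exists>h\<in>R. (w * e) ^ M = of_nat p * h)}"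
  proof safe
    fix p :: nat and M h1 assume p: "prime p" and h1: "h1 \<in> ?S" and eq: "g ^ M = of_nat p * h1"
    have "h1 * h ^ M \<in> ?S"
    proof -
      have "h ^ M \<in> ?S" by (induction M) (use e(3) S in \<open>auto simp: is_subring_def\<close>)
      then show ?thesis using h1 S by (auto simp: is_subring_def)
    qed
    then obtain G where G: "G \<in> polys_over R" "h1 * h ^ M = poly G c" by (auto simp: adjoin_def)
    have eM: "e ^ M = of_nat p * poly G c"
      unfolding G(2)[symmetric] e(4) power_mult_distrib eq by simp
    obtain k Q B where B: "Q \<in> polys_over R" "B \<in> polys_over R"
      "Polynomial.smult (lead_coeff F ^ k) G = F * Q + B" "B = 0 \<or> degree B < degree F"
      using pseudo_division_over[OF F(1) G(1) F(2)] by blast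
    have Bc: "poly B c = w ^ k * poly G c"
      using arg_cong[OF B(3), of "\<lambda>P. poly P c"] F(3) by (simp add: w_def)
    have "[:w ^ k * e ^ M:] - Polynomial.smult (of_nat p) B = 0"
    proof (rule min)
      show "[:w ^ k * e ^ M:] - Polynomial.smult (of_nat p) B \<in> polys_over R"
        by (intro polys_over_closed polys_over_const polys_over_smult subring_of_nat subring_closed subring_power w e B)
      show "poly ([:w ^ k * e ^ M:] - Polynomial.smult (of_nat p) B) c = 0"
        using Bc eM by simp
      show "degree ([:w ^ k * e ^ M:] - Polynomial.smult (of_nat p) B) < degree F"
        using B(4) n0 by (intro degree_diff_less) auto
    qed
    then have "coeff ([:w ^ k * e ^ M:] - Polynomial.smult (of_nat p) B) 0 = 0" by simp
    then have we: "w ^ k * e ^ M = of_nat p * coeff B 0" by simp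
    have "(w * e) ^ (k + M) = of_nat p * (w ^ M * e ^ k * coeff B 0)"
      using we by (simp add: power_mult_distrib power_add mult_ac)
    moreover have "w ^ M * e ^ k * coeff B 0 \<in> R"
      using B(2) by (intro subring_closed subring_power w e) (simp add: polys_over_def)
    ultimately show "\<exists>M. \<exists>h\<in>R. (w * e) ^ M = of_nat p * h" by blast
  qed
  moreover have "finite {p::nat. prime p \<and> (\<exists>M. \<exists>h\<in>R. (w * e) ^ M = of_nat p * h)}"
    using few w e subring_closed(5)[of w e] unfolding few_inverted_primes_def by simp
  ultimately show "finite {p::nat. prime p \<and> (\<exists>M. \<exists>h\<in>?S. g ^ M = of_nat p * h)}"
    by (rule finite_subset)
qed

lemma few_inverted_primes_adjoin:
  assumes few: "few_inverted_primes R"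
  shows "few_inverted_primes (adjoin R c)"
proof (cases "\<exists>P. P \<in> polys_over R \<and> P \<noteq> 0 \<and> poly P c = 0")
  case True
  define F where "F = (ARG_MIN degree P. P \<in> polys_over R \<and> P \<noteq> 0 \<and> poly P c = 0)"
  have F: "F \<in> polys_over R \<and> F \<noteq> 0 \<and> poly F c = 0"
    unfolding F_def using arg_min_natI[of "\<lambda>P. P \<in> polys_over R \<and> P \<noteq> 0 \<and> poly P c = 0" _ degree] True
    by blast
  have "degree F \<le> degree P" if "P \<in> polys_over R \<and> P \<noteq> 0 \<and> poly P c = 0" for P
    unfolding F_def using that by (rule arg_min_nat_le)
  then show ?thesis
    using F by (intro few_inverted_primes_adjoin_algebraic[OF few, of F]) (auto simp flip: not_le)
next
  case False
  then show ?thesis by (intro few_inverted_primes_adjoin_transcendental few) blast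
qed

end

lemma few_inverted_primes_Ints: "few_inverted_primes \<int>"
  unfolding few_inverted_primes_def
proof (intro ballI impI)
  fix g :: complex assume "g \<in> \<int>" "g \<noteq> 0"
  then obtain a where a: "g = of_int a" "a \<noteq> 0" by (auto elim: Ints_cases)
  have "{p::nat. prime p \<and> (\<exists>M. \<exists>h\<in>\<int>. g ^ M = of_nat p * h)} \<subseteq> {..nat \<bar>a\<bar>}"
  proof safe
    fix p :: nat and M h assume p: "prime p" and "h \<in> \<int>" and eq: "g ^ M = of_nat p * h"
    then obtain b where b: "h = of_int b" by (auto elim: Ints_cases)
    have "(of_int (a ^ M) :: complex) = of_int (int p * b)" using eq a b by simp
    then have "a ^ M = int p * b" by (simp only: of_int_eq_iff)
    then have "int p dvd a ^ M" by simp
    then have "int p dvd a" using p prime_dvd_power[of "int p" a M] by simp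
    then have "int p \<le> \<bar>a\<bar>" using a(2) dvd_imp_le_int[of a "int p"] by simp
    then show "p \<le> nat \<bar>a\<bar>" by simp
  qed
  then show "finite {p::nat. prime p \<and> (\<exists>M. \<exists>h\<in>\<int>. g ^ M = of_nat p * h)}"
    using finite_subset by blast
qed

text \<open>
  In the ring generated by finitely many complex numbers, a nonzero element is nilpotent modulo \<open>p\<close> for
  only finitely many primes \<open>p\<close>.  This replaces the reduction of the coefficients to a finite field, and
  works equally for transcendental coefficients.
\<close>

theorem finitely_generated_subring_few_inverted_primes:
  assumes "finite C"
  shows "\<exists>R. is_subring R \<and> few_inverted_primes R \<and> C \<subseteq> R"
  using assms
proof (induction C)
  case empty
  show ?case using few_inverted_primes_Ints by (intro exI[of _ \<int>]) (auto simp: is_subring_def)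
next
  case (insert c C)
  then obtain R where "is_subring R" "few_inverted_primes R" "C \<subseteq> R" by blast
  then show ?case
    using is_subring_adjoin few_inverted_primes_adjoin subset_adjoin mem_adjoin
    by (intro exI[of _ "adjoin R c"]) blast
qed

section \<open>Diagonal coefficients on the boundary of the Newton polygon\<close>

type_synonym zwpoly = "nat \<times> nat \<Rightarrow>\<^sub>0 complex"

abbreviation keys :: "('a \<Rightarrow>\<^sub>0 'b::zero) \<Rightarrow> 'a set" where "keys \<equiv> Poly_Mapping.keys"
abbreviation lookup :: "('a \<Rightarrow>\<^sub>0 'b::zero) \<Rightarrow> 'a \<Rightarrow> 'b" where "lookup \<equiv> Poly_Mapping.lookup"

lemma zw_poly_mult_hom: "zw_poly (p * q) = zw_poly p * zw_poly q"
proof (induction p rule: poly_mapping_additive_induct)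
  case (2 e c)
  show ?case
  proof (induction q rule: poly_mapping_additive_induct)
    case (2 e' d)
    obtain a b a' b' where "e = (a, b)" "e' = (a', b')" by fastforce
    then show ?case
      by (simp add: mult_single zw_poly_single Const_mult power_add mult_ac)
  qed (simp_all add: zw_poly_0 zw_poly_add distrib_left)
qed (simp_all add: zw_poly_0 zw_poly_add distrib_right)

lemma zw_poly_1: "zw_poly 1 = 1"
  using zw_poly_single[of 0 0 1] by (simp add: Const_1 zero_prod_def[symmetric])

lemma zw_poly_power: "zw_poly (p ^ m) = zw_poly p ^ m"
  by (induction m) (simp_all add: zw_poly_1 zw_poly_mult_hom)

lemma keys_bound_mult:
  fixes p q :: zwpoly and \<phi> :: "nat \<times> nat \<Rightarrow> real"
  assumes add: "\<And>e e'. \<phi> (e + e') = \<phi> e + \<phi> e'"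
    and "\<forall>e\<in>keys p. s \<le> \<phi> e" "\<forall>e\<in>keys q. t \<le> \<phi> e"
  shows "\<forall>e\<in>keys (p * q). s + t \<le> \<phi> e"
proof
  fix e assume "e \<in> keys (p * q)"
  then obtain a b where "e = a + b" "a \<in> keys p" "b \<in> keys q"
    using Poly_Mapping.keys_mult[of p q] by blast
  then show "s + t \<le> \<phi> e" using assms by (simp add: add_mono)
qed

lemma keys_bound_power:
  fixes p :: zwpoly and \<phi> :: "nat \<times> nat \<Rightarrow> real"
  assumes add: "\<And>e e'. \<phi> (e + e') = \<phi> e + \<phi> e'"
    and p: "\<forall>e\<in>keys p. t \<le> \<phi> e"
  shows "\<forall>e\<in>keys (p ^ m). m * t \<le> \<phi> e"
proof (induction m)
  case 0
  have "\<phi> 0 = 0" using add[of 0 0] by simp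
  moreover have "e = 0" if "e \<in> keys (1 :: zwpoly)" for e
    using that by (auto simp: in_keys_iff lookup_one when_def)
  ultimately show ?case by fastforce
next
  case (Suc m)
  have "\<forall>e\<in>keys (p * p ^ m). t + m * t \<le> \<phi> e"
    by (rule keys_bound_mult[where \<phi> = \<phi>, OF add p Suc])
  then show ?case by (simp add: algebra_simps)
qed

definition face :: "(nat \<times> nat \<Rightarrow> bool) \<Rightarrow> zwpoly \<Rightarrow> zwpoly" where
  "face A p = (\<Sum>e\<in>{e\<in>keys p. A e}. Poly_Mapping.single e (lookup p e))"

lemma lookup_face: "lookup (face A p) e = (if A e then lookup p e else 0)"
proof -
  have "lookup (face A p) e = (\<Sum>e'\<in>{e\<in>keys p. A e}. if e' = e then lookup p e else 0)"
    unfolding face_def lookup_sum by (rule sum.cong) (auto simp: lookup_single when_def)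
  also have "\<dots> = (if A e then lookup p e else 0)"
    by (simp add: sum.delta' in_keys_iff)
  finally show ?thesis .
qed

text \<open>
  An additive function \<open>\<phi>\<close> on exponents grades the polynomial ring.  If \<open>\<phi> \<ge> t\<close> on the support of \<open>p\<close>,
  then the lowest possible degree \<open>m * t\<close> in \<open>p ^ m\<close> only sees the part of \<open>p\<close> of degree \<open>t\<close>.
\<close>

lemma lookup_power_face:
  fixes p :: zwpoly and \<phi> :: "nat \<times> nat \<Rightarrow> real"
  assumes add: "\<And>e e'. \<phi> (e + e') = \<phi> e + \<phi> e'"
    and p: "\<forall>e\<in>keys p. t \<le> \<phi> e"
    and e: "\<phi> e = m * t"
  shows "lookup (p ^ m) e = lookup (face (\<lambda>e. \<phi> e = t) p ^ m) e"
proof -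
  define f where "f = face (\<lambda>e. \<phi> e = t) p"
  have f: "\<forall>e\<in>keys f. t \<le> \<phi> e"
    by (auto simp: f_def in_keys_iff lookup_face split: if_splits)
  have strict_mult: "\<forall>e\<in>keys (a * b). s + s' < \<phi> e"
    if "\<forall>e\<in>keys a. s < \<phi> e" "\<forall>e\<in>keys b. s' \<le> \<phi> e" for a b :: zwpoly and s s'
  proof
    fix e assume "e \<in> keys (a * b)"
    then obtain a' b' where "e = a' + b'" "a' \<in> keys a" "b' \<in> keys b"
      using Poly_Mapping.keys_mult[of a b] by blast
    then show "s + s' < \<phi> e" using that add by (simp add: add_less_le_mono)
  qed
  have "\<forall>e\<in>keys (p ^ m - f ^ m). m * t < \<phi> e"
  proof (induction m)
    case (Suc m)
    have "\<forall>e\<in>keys (p - f). t < \<phi> e"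
    proof
      fix e assume "e \<in> keys (p - f)"
      then have "lookup p e \<noteq> 0 \<and> \<phi> e \<noteq> t"
        by (auto simp: in_keys_iff lookup_minus f_def lookup_face split: if_splits)
      then show "t < \<phi> e" using p by (force simp: in_keys_iff)
    qed
    from strict_mult[OF this keys_bound_power[where \<phi> = \<phi>, OF add f]]
    have 1: "\<forall>e\<in>keys ((p - f) * f ^ m). t + m * t < \<phi> e" .
    have 2: "\<forall>e\<in>keys ((p ^ m - f ^ m) * p). m * t + t < \<phi> e"
      by (rule strict_mult[OF Suc p])
    have "p ^ Suc m - f ^ Suc m = (p ^ m - f ^ m) * p + (p - f) * f ^ m"
      by (simp add: algebra_simps)
    then have "keys (p ^ Suc m - f ^ Suc m) \<subseteq> keys ((p ^ m - f ^ m) * p) \<union> keys ((p - f) * f ^ m)"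
      using Poly_Mapping.keys_add by metis
    then show ?case using 1 2 by (fastforce simp: algebra_simps)
  qed simp
  then have "e \<notin> keys (p ^ m - f ^ m)" using e by auto
  then show ?thesis by (simp add: in_keys_iff lookup_minus f_def)
qed

text \<open>
  A line below \<open>S\<close> that touches the lower boundary of its convex hull above \<open>w = 0\<close>.  The height \<open>H\<close> is the
  smallest height at which a point of \<open>S\<close>, or a segment between a point on the left and a point on the
  right, meets the axis.  Minimality of \<open>H\<close> says that the slopes towards the points on the left do not
  exceed the slopes towards the points on the right, which leaves room for \<open>\<theta>\<close>.
\<close>

lemma supporting_line:
  fixes S :: "(real \<times> real) set"
  assumes fin: "finite S" and pos: "\<exists>(w, d)\<in>S. w \<ge> 0" and neg: "\<exists>(w, d)\<in>S. w \<le> 0"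
  obtains \<theta> H where "\<And>w d. (w, d) \<in> S \<Longrightarrow> H + \<theta> * w \<le> d"
    "(0, H) \<in> S \<or> (\<exists>w1 w2. w1 < 0 \<and> 0 < w2 \<and> (w1, H + \<theta> * w1) \<in> S \<and> (w2, H + \<theta> * w2) \<in> S)"
proof -
  define cross where "cross = (\<lambda>((w1, d1), (w2, d2)). (w2 * d1 - w1 * d2) / (w2 - w1 :: real))"
  define pairs where "pairs = {((w1, d1), (w2, d2)). (w1, d1) \<in> S \<and> (w2, d2) \<in> S \<and> w1 < 0 \<and> 0 < w2}"
  define X where "X = cross ` pairs \<union> {d. (0, d) \<in> S}"
  have "finite pairs" by (rule finite_subset[of _ "S \<times> S"]) (use fin in \<open>auto simp: pairs_def\<close>)
  moreover have "finite {d. (0, d) \<in> S}"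
    by (rule finite_subset[of _ "snd ` S"]) (use fin in force)+
  ultimately have finX: "finite X" by (simp add: X_def)
  have "X \<noteq> {}"
  proof -
    obtain w1 d1 w2 d2 where "(w1, d1) \<in> S" "w1 \<le> 0" "(w2, d2) \<in> S" "0 \<le> w2"
      using pos neg by blast
    then have "((w1, d1), (w2, d2)) \<in> pairs \<or> d1 \<in> {d. (0, d) \<in> S} \<or> d2 \<in> {d. (0, d) \<in> S}"
      by (cases "w1 = 0"; cases "w2 = 0") (auto simp: pairs_def)
    then show ?thesis unfolding X_def by blast
  qed
  define H where "H = Min X"
  have HX: "H \<in> X" unfolding H_def by (rule Min_in) fact+
  have H_le: "H \<le> x" if "x \<in> X" for x unfolding H_def using finX that by simp
  define A where "A = (\<lambda>(w, d). (d - H) / w) ` {(w, d) \<in> S. 0 < w}"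
  define B where "B = (\<lambda>(w, d). (d - H) / w) ` {(w, d) \<in> S. w < 0}"
  have finA: "finite A" and finB: "finite B"
    unfolding A_def B_def by (rule finite_imageI, rule finite_subset[OF _ fin], force)+
  have sep: "b \<le> a" if "b \<in> B" "a \<in> A" for a b
  proof -
    obtain w1 d1 where 1: "(w1, d1) \<in> S" "w1 < 0" "b = (d1 - H) / w1" using \<open>b \<in> B\<close> by (auto simp: B_def)
    obtain w2 d2 where 2: "(w2, d2) \<in> S" "w2 > 0" "a = (d2 - H) / w2" using \<open>a \<in> A\<close> by (auto simp: A_def)
    have "H \<le> cross ((w1, d1), (w2, d2))"
      using 1 2 by (intro H_le) (auto simp: X_def pairs_def)
    then have "H * (w2 - w1) \<le> w2 * d1 - w1 * d2"
      using 1 2 by (simp add: cross_def field_simps)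
    then have "(d1 - H) * w2 \<ge> (d2 - H) * w1" by (simp add: algebra_simps)
    then show ?thesis unfolding 1 2 using 1(2) 2(2) by (simp add: field_simps)
  qed
  obtain \<theta> where \<theta>: "\<And>b. b \<in> B \<Longrightarrow> b \<le> \<theta>" "\<And>a. a \<in> A \<Longrightarrow> \<theta> \<le> a"
  proof (cases "A = {}")
    case True
    show thesis by (rule that[of "if B = {} then 0 else Max B"]) (use True finB in auto)
  next
    case False
    show thesis by (rule that[of "Min A"]) (use False finA sep in auto)
  qed
  show thesis
  proof (rule that[of H \<theta>])
    fix w d assume wd: "(w, d) \<in> S"
    consider "w = 0" | "w > 0" | "w < 0" by linarith
    then show "H + \<theta> * w \<le> d"
    proof cases
      case 1
      then show ?thesis using H_le[of d] wd by (simp add: X_def)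
    next
      case 2
      then have "\<theta> \<le> (d - H) / w" using wd by (intro \<theta>) (force simp: A_def)
      then show ?thesis using 2 by (simp add: field_simps)
    next
      case 3
      then have "(d - H) / w \<le> \<theta>" using wd by (intro \<theta>) (force simp: B_def)
      then show ?thesis using 3 by (simp add: field_simps)
    qed
  next
    from HX consider "(0, H) \<in> S" | "H \<in> cross ` pairs" by (auto simp: X_def)
    then show "(0, H) \<in> S \<or> (\<exists>w1 w2. w1 < 0 \<and> 0 < w2 \<and> (w1, H + \<theta> * w1) \<in> S \<and> (w2, H + \<theta> * w2) \<in> S)"
    proof cases
      case 2
      then obtain w1 d1 w2 d2 where wd: "(w1, d1) \<in> S" "(w2, d2) \<in> S" "w1 < 0" "0 < w2"
        "H = (w2 * d1 - w1 * d2) / (w2 - w1)"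
        by (auto simp: pairs_def cross_def)
      have "H * (w2 - w1) = w2 * d1 - w1 * d2" using wd by simp
      then have eq: "(d1 - H) / w1 = (d2 - H) / w2" using wd(3,4) by (simp add: field_simps)
      have "(d1 - H) / w1 \<le> \<theta>" using wd by (intro \<theta>) (force simp: B_def)
      moreover have "\<theta> \<le> (d2 - H) / w2" using wd by (intro \<theta>) (force simp: A_def)
      ultimately have "\<theta> = (d1 - H) / w1" "\<theta> = (d2 - H) / w2" using eq by simp_all
      then have "\<theta> * w1 = d1 - H" "\<theta> * w2 = d2 - H"
        using wd(3,4) by (simp, metis less_irrefl nonzero_eq_divide_eq)
      then have "d1 = H + \<theta> * w1" "d2 = H + \<theta> * w2" by simp_all
      then show ?thesis using wd by blast
    qed simp
  qed
qed

abbreviation wt :: "nat \<times> nat \<Rightarrow> int" where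
  "wt e \<equiv> int (fst e) - int (snd e)"

text \<open>
  The substitution \<open>Z = x\<close>, \<open>W = 1/x\<close>, multiplied by \<open>x ^ N\<close> to clear negative exponents.
\<close>

definition weight_poly :: "nat \<Rightarrow> zwpoly \<Rightarrow> complex poly" where
  "weight_poly N p = (\<Sum>e\<in>keys p. monom (lookup p e) (nat (wt e + int N)))"

definition laurent_eval :: "complex \<Rightarrow> zwpoly \<Rightarrow> complex" where
  "laurent_eval x p = (\<Sum>e\<in>keys p. lookup p e * x ^ fst e * inverse x ^ snd e)"

lemma laurent_eval_power: "laurent_eval x (p ^ m) = laurent_eval x p ^ m"
proof -
  let ?r = "1 / complex_of_real (sqrt 2)"
  define v where "v i = (if i = 0 then ?r * (x + inverse x) else - \<i> * ?r * (x - inverse x))" for i :: nat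
  have rr: "?r * ?r * 2 = 1" using sqrt2_sq by (simp add: field_simps)
  have "peval v Zc = (?r * ?r * 2) * x" "peval v Wc = (?r * ?r * 2) * inverse x"
    by (simp_all only: Zc_def Wc_def peval_mult peval_add peval_diff peval_Const peval_Var)
      (auto simp: v_def algebra_simps add_divide_distrib diff_divide_distrib)
  then have "peval v Zc = x" "peval v Wc = inverse x" unfolding rr by simp_all
  then have "laurent_eval x p = peval v (zw_poly p)" for p
    by (simp add: laurent_eval_def peval_zw_poly case_prod_beta)
  then show ?thesis by (simp add: zw_poly_power peval_power)
qed

lemma poly_weight_poly:
  assumes "x \<noteq> 0" "\<forall>e\<in>keys p. - int N \<le> wt e"
  shows "poly (weight_poly N p) x = x ^ N * laurent_eval x p"
  unfolding weight_poly_def laurent_eval_def poly_sum sum_distrib_left poly_monom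
proof (rule sum.cong[OF refl])
  fix e assume "e \<in> keys p"
  then have "- int N \<le> wt e" using assms(2) by blast
  then have "nat (wt e + int N) + snd e = N + fst e" by linarith
  then have "x ^ nat (wt e + int N) * x ^ snd e = x ^ N * x ^ fst e"
    by (metis power_add)
  then show "lookup p e * x ^ nat (wt e + int N) = x ^ N * (lookup p e * x ^ fst e * inverse x ^ snd e)"
    using assms(1) by (simp add: field_simps)
qed

lemma keys_weight_bound_power:
  fixes p :: zwpoly
  assumes "\<forall>e\<in>keys p. - int N \<le> wt e"
  shows "\<forall>e\<in>keys (p ^ m). - int (N * m) \<le> wt e"
proof
  fix e assume e: "e \<in> keys (p ^ m)"
  have "\<forall>e\<in>keys p. - real N \<le> real_of_int (wt e)"
  proof
    fix e assume "e \<in> keys p"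
    then have "- int N \<le> wt e" using assms by blast
    then have "real_of_int (- int N) \<le> real_of_int (wt e)" by (simp only: of_int_le_iff)
    then show "- real N \<le> real_of_int (wt e)" by simp
  qed
  from keys_bound_power[where \<phi> = "\<lambda>e. real_of_int (wt e)", OF _ this, of m] e
  have "real m * - real N \<le> real_of_int (wt e)" by simp
  then have "real_of_int (- int (N * m)) \<le> real_of_int (wt e)"
    by (simp add: mult.commute)
  then show "- int (N * m) \<le> wt e" by (simp only: of_int_le_iff)
qed

lemma weight_poly_power:
  assumes "\<forall>e\<in>keys p. - int N \<le> wt e"
  shows "weight_poly (N * m) (p ^ m) = weight_poly N p ^ m"
proof -
  note m = keys_weight_bound_power[OF assms]
  have "poly (weight_poly (N * m) (p ^ m)) x = poly (weight_poly N p ^ m) x" if "x \<noteq> 0" for x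
    using poly_weight_poly[OF that m] poly_weight_poly[OF that assms]
    by (simp add: laurent_eval_power poly_power power_mult power_mult_distrib)
  then have "UNIV - {0} \<subseteq> {x. poly (weight_poly (N * m) (p ^ m) - weight_poly N p ^ m) x = 0}"
    by auto
  moreover have "infinite (UNIV - {0 :: complex})" by (simp add: infinite_UNIV_char_0)
  ultimately have "weight_poly (N * m) (p ^ m) - weight_poly N p ^ m = 0"
    using poly_roots_finite finite_subset by blast
  then show ?thesis by simp
qed

lemma coeff_weight_poly:
  assumes "\<forall>e\<in>keys p. - int N \<le> wt e"
  shows "coeff (weight_poly N p) i = (\<Sum>e\<in>{e\<in>keys p. wt e + int N = int i}. lookup p e)"
proof -
  have "coeff (weight_poly N p) i = (\<Sum>e\<in>keys p. if wt e + int N = int i then lookup p e else 0)"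
    unfolding weight_poly_def coeff_sum by (rule sum.cong) (use assms in \<open>force simp: nat_eq_iff\<close>)+
  then show ?thesis by (simp add: sum.If_cases Int_def)
qed

text \<open>
  Plot a monomial \<open>Z ^ a W ^ b\<close> at the point \<open>(a - b, a + b)\<close>.  Let \<open>H\<close> be the height at which the
  vertical axis enters the convex hull of the support of \<open>c\<close>.  No power \<open>c ^ n\<close> has a diagonal monomial below
  height \<open>n H\<close>, and at height \<open>n H\<close> the coefficient is the constant term of a power of a one-variable Laurent
  polynomial, namely the part of \<open>c\<close> on a supporting line.  By the one-variable theorem it is nonzero for some
  \<open>m\<close>.
\<close>

theorem diagonal_coefficient_on_lower_boundary:
  fixes c :: zwpoly
  assumes nonneg: "\<exists>e\<in>keys c. 0 \<le> wt e" and nonpos: "\<exists>e\<in>keys c. wt e \<le> 0"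
  obtains H :: real and m k where "m > 0" "lookup (c ^ m) (k, k) \<noteq> 0" "2 * real k = m * H"
    "\<And>n i. lookup (c ^ n) (i, i) \<noteq> 0 \<Longrightarrow> n * H \<le> 2 * real i"
proof -
  define pt where "pt e = (real_of_int (wt e), real (fst e) + real (snd e))" for e :: "nat \<times> nat"
  have "\<exists>(w, d)\<in>pt ` keys c. w \<ge> 0"
    using nonneg by (force simp: pt_def)
  moreover have "\<exists>(w, d)\<in>pt ` keys c. w \<le> 0"
    using nonpos by (force simp: pt_def)
  ultimately obtain \<theta> H where
    above: "\<And>w d. (w, d) \<in> pt ` keys c \<Longrightarrow> H + \<theta> * w \<le> d"
    and touch: "(0, H) \<in> pt ` keys c \<or> (\<exists>w1 w2. w1 < 0 \<and> 0 < w2 \<and> (w1, H + \<theta> * w1) \<in> pt ` keys c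
        \<and> (w2, H + \<theta> * w2) \<in> pt ` keys c)"
    using supporting_line[of "pt ` keys c"] finite_keys by (metis finite_imageI)
  define \<phi> where "\<phi> e = snd (pt e) - \<theta> * fst (pt e)" for e
  have add: "\<phi> (e + e') = \<phi> e + \<phi> e'" for e e'
    by (simp add: \<phi>_def pt_def algebra_simps)
  have \<phi>: "\<forall>e\<in>keys c. H \<le> \<phi> e"
  proof
    fix e assume "e \<in> keys c"
    then show "H \<le> \<phi> e" using above[of "fst (pt e)" "snd (pt e)"] by (simp add: \<phi>_def)
  qed
  have diag: "\<phi> (i, i) = 2 * real i" for i by (simp add: \<phi>_def pt_def)
  have low: "n * H \<le> 2 * real i" if "lookup (c ^ n) (i, i) \<noteq> 0" for n i
    using keys_bound_power[where \<phi> = \<phi>, OF add \<phi>, of n] that diag[of i] by (force simp: in_keys_iff)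
  define f where "f = face (\<lambda>e. \<phi> e = H) c"
  have f_keys: "e \<in> keys f \<longleftrightarrow> e \<in> keys c \<and> \<phi> e = H" for e
    by (auto simp: f_def in_keys_iff lookup_face)
  have inj: "e = e'" if "\<phi> e = \<phi> e'" "wt e = wt e'" for e e'
  proof -
    have "fst (pt e) = fst (pt e')" using that(2) by (simp add: pt_def)
    then have "snd (pt e) = snd (pt e')" using that(1) by (simp add: \<phi>_def)
    then have "fst e + snd e = fst e' + snd e'" unfolding pt_def by (simp flip: of_nat_add)
    then show ?thesis using that(2) by (intro prod_eqI) linarith+
  qed
  have "\<exists>m k. m > 0 \<and> lookup (c ^ m) (k, k) \<noteq> 0 \<and> 2 * real k = m * H"
    using touch
  proof
    assume "(0, H) \<in> pt ` keys c"
    then obtain a b where ab: "(a, b) \<in> keys c" "pt (a, b) = (0, H)" by auto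
    then have "a = b" "2 * real a = 1 * H" by (auto simp: pt_def)
    then show ?thesis using ab(1) by (intro exI[of _ 1] exI[of _ a]) (simp add: in_keys_iff)
  next
    assume "\<exists>w1 w2. w1 < 0 \<and> 0 < w2 \<and> (w1, H + \<theta> * w1) \<in> pt ` keys c
        \<and> (w2, H + \<theta> * w2) \<in> pt ` keys c"
    then obtain w1 w2 e1 e2 where *: "w1 < 0" "0 < w2" "e1 \<in> keys c" "(w1, H + \<theta> * w1) = pt e1"
      "e2 \<in> keys c" "(w2, H + \<theta> * w2) = pt e2" by blast
    have "fst (pt e1) < 0" "0 < fst (pt e2)" "\<phi> e1 = H" "\<phi> e2 = H"
      using *(1,2) by (simp_all add: \<phi>_def flip: *(4,6))
    then have e: "e1 \<in> keys f" "wt e1 < 0" "e2 \<in> keys f" "0 < wt e2"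
      using *(3,5) by (auto simp: f_keys pt_def)
    \<comment> \<open>On the supporting line a monomial is determined by its weight, so no cancellation occurs in
       passing from \<open>f\<close> to the one-variable polynomial \<open>q\<close>.\<close>
    define v where "v = Min (wt ` keys f)"
    have v_le: "v \<le> wt e" if "e \<in> keys f" for e unfolding v_def using that by (intro Min_le) auto
    have "v \<in> wt ` keys f" unfolding v_def using e by (intro Min_in) auto
    then obtain e0 where e0: "e0 \<in> keys f" "wt e0 = v" by auto
    have v0: "v < 0" using v_le[OF e(1)] e(2) by simp
    define u where "u = nat (- v)"
    have u: "int u = - v" using v0 by (simp add: u_def)
    have wtf: "\<forall>e\<in>keys f. - int u \<le> wt e" using v_le u by auto
    define q where "q = weight_poly u f"
    have q: "coeff q i = lookup f e" if "e \<in> keys f" "int i = wt e + int u" for e i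
    proof -
      have "{e'\<in>keys f. wt e' + int u = int i} = {e}"
      proof (intro equalityI subsetI)
        fix e' assume "e' \<in> {e'\<in>keys f. wt e' + int u = int i}"
        then have "e' = e" using that by (intro inj) (auto simp: f_keys)
        then show "e' \<in> {e}" by simp
      qed (use that in auto)
      then show ?thesis unfolding q_def coeff_weight_poly[OF wtf] by simp
    qed
    have "coeff q 0 \<noteq> 0" using q[OF e0(1), of 0] e0 u by (simp add: in_keys_iff)
    moreover have "u \<le> degree q"
    proof -
      have "coeff q (nat (wt e2) + u) \<noteq> 0"
        using q[OF e(3), of "nat (wt e2) + u"] e by (simp add: in_keys_iff)
      then show ?thesis using le_degree by fastforce
    qed
    ultimately obtain m where m: "m > 0" "coeff (q ^ m) (u * m) \<noteq> 0"
      using constant_term_power_nonzero by blast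
    have wtfm: "\<forall>e\<in>keys (f ^ m). - int (u * m) \<le> wt e"
      by (rule keys_weight_bound_power[OF wtf])
    have "{e\<in>keys (f ^ m). wt e + int (u * m) = int (u * m)} \<noteq> {}"
    proof
      assume "{e\<in>keys (f ^ m). wt e + int (u * m) = int (u * m)} = {}"
      from coeff_weight_poly[OF wtfm, of "u * m", unfolded this] have "coeff (q ^ m) (u * m) = 0"
        unfolding q_def weight_poly_power[OF wtf] by (simp only: sum.empty)
      then show False using m(2) by contradiction
    qed
    then obtain e where e: "e \<in> keys (f ^ m)" "wt e = 0" by auto
    obtain k where k: "e = (k, k)" using e(2) by (cases e) auto
    have "\<forall>e\<in>keys f. - H \<le> - \<phi> e" by (simp add: f_keys)
    from keys_bound_power[of "\<lambda>e. - \<phi> e", OF _ this, of m] e(1) have "\<phi> e \<le> m * H" by (auto simp: add)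
    moreover have "\<forall>e\<in>keys f. H \<le> \<phi> e" by (simp add: f_keys)
    from keys_bound_power[where \<phi> = \<phi>, OF add this, of m] e(1) have "m * H \<le> \<phi> e" by auto
    ultimately have \<phi>e: "\<phi> e = m * H" by simp
    then have "lookup (c ^ m) (k, k) \<noteq> 0"
      using lookup_power_face[OF add \<phi> \<phi>e] e(1) by (simp add: f_def k in_keys_iff)
    then show ?thesis using m(1) \<phi>e diag[of k] k by (intro exI[of _ m] exI[of _ k]) auto
  qed
  then show thesis using that low by blast
qed

section \<open>Reduction modulo primes\<close>

text \<open>
  The expectation of a polynomial in \<open>Z\<close> and \<open>W\<close>, written in terms of its coefficients: the linear functional
  with value \<open>a!\<close> at \<open>Z ^ a W ^ a\<close> and \<open>0\<close> at the other monomials.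
\<close>

definition gauss_sum :: "zwpoly \<Rightarrow> complex" where
  "gauss_sum c = (\<Sum>e\<in>keys c. lookup c e * (if fst e = snd e then fact (fst e) else 0))"

lemma gauss_sum_diagonal:
  assumes "\<And>k. lookup c (k, k) \<noteq> 0 \<Longrightarrow> k \<le> N"
  shows "gauss_sum c = (\<Sum>k\<le>N. fact k * lookup c (k, k))"
proof -
  have "gauss_sum c = (\<Sum>e\<in>{e \<in> keys c. fst e = snd e}. lookup c e * fact (fst e))"
    unfolding gauss_sum_def by (rule sum.mono_neutral_cong_right) auto
  also have "\<dots> = (\<Sum>e\<in>(\<lambda>k. (k, k)) ` {..N}. lookup c e * fact (fst e))"
    by (rule sum.mono_neutral_left) (use assms in \<open>auto simp: in_keys_iff\<close>)
  also have "\<dots> = (\<Sum>k\<le>N. fact k * lookup c (k, k))"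
    by (subst sum.reindex) (auto simp: inj_on_def mult.commute)
  finally show ?thesis .
qed

text \<open>
  The binomial congruence for \<open>p\<close>-th powers, with control over the ring \<open>S\<close> that contains the quotient \<open>r\<close>.
\<close>

lemma sum_power_prime:
  fixes y :: "'i \<Rightarrow> 'a::comm_ring_1"
  assumes p: "prime p" and fin: "finite A"
    and closed: "1 \<in> S" "\<And>a b. a \<in> S \<Longrightarrow> b \<in> S \<Longrightarrow> a + b \<in> S" "\<And>a b. a \<in> S \<Longrightarrow> b \<in> S \<Longrightarrow> a * b \<in> S" "0 \<in> S"
    and y: "\<And>i. i \<in> A \<Longrightarrow> y i \<in> S"
  shows "\<exists>r\<in>S. (\<Sum>i\<in>A. y i) ^ p = (\<Sum>i\<in>A. y i ^ p) + of_nat p * r"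
proof -
  have p0: "p > 0" using p by (rule prime_gt_0_nat)
  have nat: "of_nat n \<in> S" for n by (induction n) (auto intro: closed)
  have pow: "a ^ n \<in> S" if "a \<in> S" for a n by (induction n) (auto intro: closed that)
  have sums: "(\<And>i. i \<in> B \<Longrightarrow> f i \<in> S) \<Longrightarrow> sum f B \<in> S" for f :: "nat \<Rightarrow> 'a" and B
    by (induction B rule: infinite_finite_induct) (auto intro: closed)
  have two: "\<exists>r\<in>S. (a + b) ^ p = a ^ p + b ^ p + of_nat p * r" if "a \<in> S" "b \<in> S" for a b
  proof
    define r where "r = (\<Sum>k\<in>{1..<p}. of_nat ((p choose k) div p) * a ^ k * b ^ (p - k))"
    show "r \<in> S" unfolding r_def by (intro sums closed nat pow that)
    have split: "{..p} = {0, p} \<union> {1..<p}" using p0 by auto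
    have "(a + b) ^ p = (\<Sum>k\<le>p. of_nat (p choose k) * a ^ k * b ^ (p - k))" by (rule binomial_ring)
    also have "\<dots> = a ^ p + b ^ p + (\<Sum>k\<in>{1..<p}. of_nat (p choose k) * a ^ k * b ^ (p - k))"
      unfolding split using p0 by (subst sum.union_disjoint) auto
    also have "(\<Sum>k\<in>{1..<p}. of_nat (p choose k) * a ^ k * b ^ (p - k)) = of_nat p * r"
      unfolding r_def sum_distrib_left
    proof (rule sum.cong[OF refl])
      fix k assume "k \<in> {1..<p}"
      then have "p dvd (p choose k)" using p by (intro dvd_choose_prime) auto
      then have "(of_nat (p choose k) :: 'a) = of_nat p * of_nat ((p choose k) div p)"
        by (metis dvd_mult_div_cancel of_nat_mult)
      then show "of_nat (p choose k) * a ^ k * b ^ (p - k) = of_nat p * (of_nat ((p choose k) div p) * a ^ k * b ^ (p - k))"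
        by (simp add: mult.assoc)
    qed
    finally show "(a + b) ^ p = a ^ p + b ^ p + of_nat p * r" .
  qed
  have "(\<Sum>i\<in>A. y i) \<in> S \<and> ?thesis"
    using fin y
  proof (induction A rule: finite_induct)
    case empty
    then show ?case using p0 closed(4) by (auto simp: power_0_left intro!: bexI[of _ 0])
  next
    case (insert i A)
    then obtain r where r: "r \<in> S" "(\<Sum>i\<in>A. y i) ^ p = (\<Sum>i\<in>A. y i ^ p) + of_nat p * r"
      and S: "(\<Sum>i\<in>A. y i) \<in> S" by auto
    have yi: "y i \<in> S" using insert by simp
    obtain r' where r': "r' \<in> S" "(y i + (\<Sum>i\<in>A. y i)) ^ p = y i ^ p + (\<Sum>i\<in>A. y i) ^ p + of_nat p * r'"
      using two[OF yi S] by blast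
    have "(\<Sum>i\<in>insert i A. y i) ^ p = (\<Sum>i\<in>insert i A. y i ^ p) + of_nat p * (r + r')"
      using insert r r' by (simp add: algebra_simps)
    then show ?case using insert r r' yi S closed by auto
  qed
  then show ?thesis by blast
qed

lemma lookup_of_nat_mult: "lookup (of_nat n * p) e = of_nat n * lookup p e"
  for p :: zwpoly
  by (induction n) (simp_all add: distrib_right lookup_add)

lemma single_power: "Poly_Mapping.single (a, b) r ^ n = Poly_Mapping.single (n * a, n * b) (r ^ n)"
  for r :: complex
proof (induction n)
  case 0
  show ?case by (simp flip: single_one zero_prod_def)
qed (simp add: mult_single)

definition coeffs_in :: "complex set \<Rightarrow> zwpoly set" where
  "coeffs_in R = {p. \<forall>e. lookup p e \<in> R}"

lemma coeffs_in_closed: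
  assumes R: "is_subring R"
  shows "1 \<in> coeffs_in R" "0 \<in> coeffs_in R"
    "p \<in> coeffs_in R \<Longrightarrow> q \<in> coeffs_in R \<Longrightarrow> p + q \<in> coeffs_in R"
    "p \<in> coeffs_in R \<Longrightarrow> q \<in> coeffs_in R \<Longrightarrow> p * q \<in> coeffs_in R"
    "r \<in> R \<Longrightarrow> Poly_Mapping.single e r \<in> coeffs_in R"
proof -
  note R_closed = subring_closed[OF R]
  show "1 \<in> coeffs_in R" "0 \<in> coeffs_in R"
    using R_closed by (auto simp: coeffs_in_def lookup_one when_def)
  show "p \<in> coeffs_in R \<Longrightarrow> q \<in> coeffs_in R \<Longrightarrow> p + q \<in> coeffs_in R"
    using R_closed by (auto simp: coeffs_in_def lookup_add)
  show "r \<in> R \<Longrightarrow> Poly_Mapping.single e r \<in> coeffs_in R"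
    using R_closed by (auto simp: coeffs_in_def lookup_single when_def)
  show "p * q \<in> coeffs_in R" if "p \<in> coeffs_in R" "q \<in> coeffs_in R"
    unfolding coeffs_in_def
  proof (intro CollectI allI)
    fix e
    have qR: "lookup q l \<in> R" for l using that(2) unfolding coeffs_in_def by blast
    have "(lookup q l when e = k + l) \<in> R" for k l
      using qR[of l] R_closed(2) by (cases "e = k + l") simp_all
    then have "(\<Sum>l. lookup q l when e = k + l) \<in> R" for k
      unfolding Sum_any.expand_set by (intro subring_sum[OF R])
    then show "lookup (p * q) e \<in> R"
      unfolding lookup_mult Sum_any.expand_set[of "\<lambda>k. lookup p k * (\<Sum>l. lookup q l when e = k + l)"]
      using that by (intro subring_sum[OF R] R_closed) (auto simp: coeffs_in_def)
  qed
qed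

lemma coeffs_in_power:
  assumes "is_subring R" "p \<in> coeffs_in R"
  shows "p ^ n \<in> coeffs_in R"
  by (induction n) (use assms coeffs_in_closed in auto)

lemma fact_diff_dvd:
  assumes "p > 0" "p * k0 < k" "p dvd k"
  shows "p * fact (p * k0) dvd (fact k :: nat)"
proof -
  obtain k' where k': "k = Suc k'" using assms by (cases k) auto
  have "fact (p * k0) dvd (fact k' :: nat)" using assms k' by (intro fact_dvd) simp
  then show ?thesis using assms(3) unfolding k' fact_Suc by (simp only: mult_dvd_mono of_nat_id)
qed

text \<open>
  Modulo \<open>p\<close>, the coefficient of \<open>G ^ p\<close> at an exponent is the \<open>p\<close>-th power of a coefficient of \<open>G\<close> if the
  exponent is divisible by \<open>p\<close>, and \<open>0\<close> otherwise.  Divide the sum \<open>gauss_sum (G ^ p)\<close> by \<open>(p k0)!\<close>.  The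
  term with \<open>k = p k0\<close> becomes \<open>lookup G (k0, k0) ^ p\<close> modulo \<open>p\<close>.  A later term is divisible by \<open>p\<close>: if \<open>p\<close>
  divides \<open>k\<close>, because \<open>k! / (p k0)!\<close> contains the factor \<open>k\<close>, and otherwise because its coefficient is.
  Earlier terms would spoil this, and are excluded by the hypothesis on the support.
\<close>

theorem diagonal_coefficient_power_divisible:
  fixes G :: zwpoly
  assumes R: "is_subring R" and G: "G \<in> coeffs_in R" and p: "prime p"
    and zero: "gauss_sum (G ^ p) = 0"
    and low: "\<And>k. lookup (G ^ p) (k, k) \<noteq> 0 \<Longrightarrow> p * k0 \<le> k"
  shows "\<exists>h\<in>R. lookup G (k0, k0) ^ p = of_nat p * h"
proof -
  note R_closed = subring_closed[OF R]
  have p0: "p > 0" using p by (rule prime_gt_0_nat)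
  have "G = (\<Sum>e\<in>keys G. Poly_Mapping.single e (lookup G e))"
    by (rule poly_mapping_eqI) (auto simp: lookup_sum lookup_single when_def in_keys_iff)
  moreover have "\<exists>r\<in>coeffs_in R. (\<Sum>e\<in>keys G. Poly_Mapping.single e (lookup G e)) ^ p =
      (\<Sum>e\<in>keys G. Poly_Mapping.single e (lookup G e) ^ p) + of_nat p * r"
    using G by (intro sum_power_prime[OF p] coeffs_in_closed[OF R]) (auto simp: coeffs_in_def)
  ultimately obtain r where r: "r \<in> coeffs_in R"
    "G ^ p = (\<Sum>e\<in>keys G. Poly_Mapping.single e (lookup G e) ^ p) + of_nat p * r" by auto
  have rR: "lookup r e \<in> R" for e using r(1) unfolding coeffs_in_def by blast
  have Gp: "lookup (G ^ p) (k, k) = (if p dvd k then lookup G (k div p, k div p) ^ p else 0) + of_nat p * lookup r (k, k)" for k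
  proof -
    have "lookup (\<Sum>e\<in>keys G. Poly_Mapping.single e (lookup G e) ^ p) (k, k) =
        (\<Sum>e\<in>keys G. if e = (k div p, k div p) then (if p dvd k then lookup G e ^ p else 0) else 0)"
      unfolding lookup_sum
    proof (rule sum.cong[OF refl])
      fix e
      show "lookup (Poly_Mapping.single e (lookup G e) ^ p) (k, k) =
          (if e = (k div p, k div p) then (if p dvd k then lookup G e ^ p else 0) else 0)"
        using p0 by (cases e) (auto simp: single_power lookup_single when_def)
    qed
    also have "\<dots> = (if p dvd k then lookup G (k div p, k div p) ^ p else 0)"
      using p0 by (simp add: sum.delta in_keys_iff)
    finally show ?thesis by (simp add: r(2) lookup_add lookup_of_nat_mult)
  qed
  define N where "N = (p * k0) + (\<Sum>e\<in>keys (G ^ p). fst e)"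
  have "k \<le> N" if "lookup (G ^ p) (k, k) \<noteq> 0" for k
  proof -
    have "(k, k) \<in> keys (G ^ p)" using that by (simp add: in_keys_iff)
    from member_le_sum[OF this, of fst] show ?thesis by (simp add: N_def)
  qed
  then have "0 = (\<Sum>k\<le>N. fact k * lookup (G ^ p) (k, k))"
    using gauss_sum_diagonal zero by metis
  also have "\<dots> = (\<Sum>k\<in>{p * k0..N}. fact k * lookup (G ^ p) (k, k))"
    by (rule sum.mono_neutral_right) (use low in force)+
  also have "\<dots> = fact (p * k0) * lookup (G ^ p) (p * k0, p * k0) + (\<Sum>k\<in>{p * k0<..N}. fact k * lookup (G ^ p) (k, k))"
    by (rule sum.head) (simp add: N_def)
  finally have eq: "0 = fact (p * k0) * lookup (G ^ p) (p * k0, p * k0) + (\<Sum>k\<in>{p * k0<..N}. fact k * lookup (G ^ p) (k, k))" .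
  have "\<exists>\<rho>\<in>R. fact k * lookup (G ^ p) (k, k) = fact (p * k0) * of_nat p * \<rho>" if k: "p * k0 < k" for k
  proof (cases "p dvd k")
    case True
    then obtain n where n: "(fact k :: nat) = p * fact (p * k0) * n"
      using fact_diff_dvd[OF p0 k] by (auto simp: dvd_def)
    have "lookup (G ^ p) (k, k) \<in> R" using coeffs_in_power[OF R G] by (simp add: coeffs_in_def)
    moreover have "(fact k :: complex) = of_nat p * fact (p * k0) * of_nat n"
      using arg_cong[OF n, of "of_nat :: nat \<Rightarrow> complex"] by simp
    ultimately show ?thesis
      by (intro bexI[of _ "of_nat n * lookup (G ^ p) (k, k)"] R_closed subring_of_nat[OF R])
        (simp_all add: mult_ac)
  next
    case False
    obtain n where n: "(fact k :: nat) = fact (p * k0) * n"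
      using fact_dvd[of "p * k0" k] k by (auto simp: dvd_def)
    have "(fact k :: complex) = fact (p * k0) * of_nat n"
      using arg_cong[OF n, of "of_nat :: nat \<Rightarrow> complex"] by simp
    then show ?thesis using False
      by (intro bexI[of _ "of_nat n * lookup r (k, k)"] R_closed subring_of_nat[OF R] rR)
        (simp_all add: Gp mult_ac)
  qed
  then obtain \<rho> where \<rho>: "\<And>k. p * k0 < k \<Longrightarrow> \<rho> k \<in> R"
    "\<And>k. p * k0 < k \<Longrightarrow> fact k * lookup (G ^ p) (k, k) = fact (p * k0) * of_nat p * \<rho> k"
    by metis
  have "(\<Sum>k\<in>{p * k0<..N}. fact k * lookup (G ^ p) (k, k)) = fact (p * k0) * of_nat p * (\<Sum>k\<in>{p * k0<..N}. \<rho> k)"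
    unfolding sum_distrib_left by (rule sum.cong) (use \<rho> in auto)
  with eq have "0 = fact (p * k0) * (lookup (G ^ p) (p * k0, p * k0) + of_nat p * (\<Sum>k\<in>{p * k0<..N}. \<rho> k))"
    by (simp add: algebra_simps)
  then have "lookup (G ^ p) (p * k0, p * k0) + of_nat p * (\<Sum>k\<in>{p * k0<..N}. \<rho> k) = 0" by simp
  then have "lookup G (k0, k0) ^ p = of_nat p * (- lookup r (p * k0, p * k0) - (\<Sum>k\<in>{p * k0<..N}. \<rho> k))"
    using p0 by (simp add: Gp algebra_simps eq_neg_iff_add_eq_0)
  moreover have "- lookup r (p * k0, p * k0) - (\<Sum>k\<in>{p * k0<..N}. \<rho> k) \<in> R"
    using \<rho>(1) by (intro R_closed rR subring_sum[OF R]) auto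
  ultimately show ?thesis by blast
qed

text \<open>
  If both signs of the weight occurred, or weight \<open>0\<close>, a power \<open>c ^ m\<close> would have a nonzero diagonal coefficient on the lower
  boundary.  By the preceding lemma it would be nilpotent modulo every prime, in a finitely generated ring.
\<close>

theorem one_sided_weights:
  fixes c :: zwpoly
  assumes "\<And>m. m \<ge> 1 \<Longrightarrow> gauss_sum (c ^ m) = 0"
  shows "(\<forall>e\<in>keys c. wt e \<ge> 1) \<or> (\<forall>e\<in>keys c. wt e \<le> - 1)"
proof (rule ccontr)
  assume "\<not> ?thesis"
  then have "\<exists>e\<in>keys c. 0 \<le> wt e" "\<exists>e\<in>keys c. wt e \<le> 0" by force+
  from diagonal_coefficient_on_lower_boundary[OF this]
  obtain H :: real and m k0 where m: "m > 0" and nz: "lookup (c ^ m) (k0, k0) \<noteq> 0" and k0: "2 * real k0 = m * H"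
    and low: "\<And>n i. lookup (c ^ n) (i, i) \<noteq> 0 \<Longrightarrow> n * H \<le> 2 * real i" by metis
  obtain R where R: "is_subring R" "few_inverted_primes R" "lookup c ` keys c \<subseteq> R"
    using finitely_generated_subring_few_inverted_primes[of "lookup c ` keys c"] by auto
  have "lookup c e \<in> R" for e
    using R(3) subring_closed(2)[OF R(1)] by (cases "e \<in> keys c") (auto simp: in_keys_iff)
  then have "c ^ m \<in> coeffs_in R" by (intro coeffs_in_power R) (simp add: coeffs_in_def)
  note G = this
  have "\<exists>h\<in>R. lookup (c ^ m) (k0, k0) ^ p = of_nat p * h" if p: "prime p" for p
  proof (rule diagonal_coefficient_power_divisible[OF R(1) G p])
    have mp: "(c ^ m) ^ p = c ^ (m * p)" by (simp add: power_mult)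
    show "gauss_sum ((c ^ m) ^ p) = 0"
      unfolding mp using m prime_gt_0_nat[OF p] by (intro assms) simp
    fix k assume "lookup ((c ^ m) ^ p) (k, k) \<noteq> 0"
    then have "real (m * p) * H \<le> 2 * real k" unfolding mp by (rule low)
    moreover have "real (m * p) * H = real p * (2 * real k0)" unfolding k0 by simp
    ultimately have "real (p * k0) \<le> real k" unfolding of_nat_mult by linarith
    then show "p * k0 \<le> k" by (simp only: of_nat_le_iff)
  qed
  then have "{p::nat. prime p} \<subseteq> {p::nat. prime p \<and> (\<exists>M. \<exists>h\<in>R. lookup (c ^ m) (k0, k0) ^ M = of_nat p * h)}"
    by blast
  moreover have "lookup (c ^ m) (k0, k0) \<in> R" using G by (simp add: coeffs_in_def)
  ultimately have "finite {p::nat. prime p}"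
    using R(2) nz unfolding few_inverted_primes_def by (meson finite_subset)
  then show False using primes_infinite by simp
qed

section \<open>Moments of the complex Gaussian\<close>

definition normal_moment :: "nat \<Rightarrow> real" where
  "normal_moment n = (if even n then fact n / (2 ^ (n div 2) * fact (n div 2)) else 0)"

lemma std_normal_integral_power:
  "integral\<^sup>L lborel (\<lambda>x. std_normal_density x * x ^ n) = normal_moment n"
proof (cases "even n")
  case True
  then obtain k where "n = 2 * k" by (auto elim: evenE)
  then show ?thesis using integral_std_normal_moment_even[of k] by (simp add: normal_moment_def)
next
  case False
  then obtain k where "n = 2 * k + 1" by (auto elim: oddE)
  then show ?thesis using integral_std_normal_moment_odd[of k] by (simp add: normal_moment_def)
qed

text \<open>
  The binomial expansion of the \<open>n\<close>-th moment of \<open>a X + b Y\<close>.  The result has the form of a one-dimensional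
  moment of variance \<open>a\<^sup>2 + b\<^sup>2\<close>, but \<open>a\<close> and \<open>b\<close> are complex, so it is proved as an identity of finite sums.
\<close>

lemma sum_binomial_normal_moments:
  fixes a b :: complex
  shows "(\<Sum>i\<le>n. of_nat (n choose i) * a ^ i * b ^ (n - i) * of_real (normal_moment i * normal_moment (n - i))) =
    of_real (normal_moment n) * (a ^ 2 + b ^ 2) ^ (n div 2)"
proof (cases "even n")
  case False
  then have "normal_moment i * normal_moment (n - i) = 0" if "i \<le> n" for i
    using that by (auto simp: normal_moment_def)
  moreover have "normal_moment n = 0" using False by (simp add: normal_moment_def)
  ultimately show ?thesis by (simp add: sum.neutral)
next
  case True
  then obtain k where n: "n = 2 * k" by (auto elim: evenE)
  let ?f = "\<lambda>i. of_nat (n choose i) * a ^ i * b ^ (n - i) * of_real (normal_moment i * normal_moment (n - i))"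
  have "(\<Sum>i\<le>n. ?f i) = (\<Sum>i\<in>(\<lambda>l. 2 * l) ` {..k}. ?f i)"
  proof (rule sum.mono_neutral_right)
    show "\<forall>i\<in>{..n} - (\<lambda>l. 2 * l) ` {..k}. ?f i = 0"
    proof
      fix i assume i: "i \<in> {..n} - (\<lambda>l. 2 * l) ` {..k}"
      have "odd i"
      proof
        assume "even i"
        then obtain l where "i = 2 * l" by (auto elim: evenE)
        then show False using i by (auto simp: n)
      qed
      then show "?f i = 0" by (simp add: normal_moment_def)
    qed
  qed (auto simp: n)
  also have "\<dots> = (\<Sum>l\<le>k. ?f (2 * l))"
    by (subst sum.reindex) (auto simp: inj_on_def)
  also have "\<dots> = (\<Sum>l\<le>k. of_real (normal_moment n) * (of_nat (k choose l) * (a ^ 2) ^ l * (b ^ 2) ^ (k - l)))"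
  proof (rule sum.cong[OF refl])
    fix l assume "l \<in> {..k}"
    then have l: "l \<le> k" by simp
    then have d: "2 * k - 2 * l = 2 * (k - l)" by simp
    have "real (2 * k choose (2 * l)) * (normal_moment (2 * l) * normal_moment (2 * k - 2 * l)) = normal_moment (2 * k) * real (k choose l)"
    proof -
      have "real (2 * k choose (2 * l)) = fact (2 * k) / (fact (2 * l) * fact (2 * (k - l)))"
        using l by (simp add: binomial_fact d)
      moreover have "real (k choose l) = fact k / (fact l * fact (k - l))"
        using l by (simp add: binomial_fact)
      moreover have "(2 :: real) ^ k = 2 ^ l * 2 ^ (k - l)"
        using l by (simp flip: power_add)
      ultimately show ?thesis by (simp add: normal_moment_def d)
    qed
    then have "of_nat (2 * k choose (2 * l)) * complex_of_real (normal_moment (2 * l) * normal_moment (2 * k - 2 * l)) = of_real (normal_moment (2 * k)) * of_nat (k choose l)"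
      by (metis of_real_mult of_real_of_nat_eq)
    then show "?f (2 * l) = of_real (normal_moment n) * (of_nat (k choose l) * (a ^ 2) ^ l * (b ^ 2) ^ (k - l))"
      unfolding n d power_mult by (simp add: mult_ac)
  qed
  also have "\<dots> = of_real (normal_moment n) * (a ^ 2 + b ^ 2) ^ (n div 2)"
    unfolding sum_distrib_left[symmetric] binomial_ring[symmetric] by (simp add: n)
  finally show ?thesis .
qed

context
  fixes M :: "'w measure" and X :: "nat \<Rightarrow> 'w \<Rightarrow> real"
  assumes gauss: "std_gaussian_vector M 2 X"
begin

lemma gaussian_monomial:
  "integrable M (\<lambda>\<omega>. complex_of_real (X 0 \<omega>) ^ i * complex_of_real (X 1 \<omega>) ^ j)" (is ?int)
  "(LINT \<omega>|M. complex_of_real (X 0 \<omega>) ^ i * complex_of_real (X 1 \<omega>) ^ j) =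
     of_real (normal_moment i * normal_moment j)" (is ?eq)
proof -
  interpret prob_space M using gauss by (simp add: std_gaussian_vector_def)
  have ind: "indep_vars (\<lambda>_. borel) X {..<2}" and dist: "\<And>i. i < 2 \<Longrightarrow> distributed M lborel (X i) std_normal_density"
    using gauss by (auto simp: std_gaussian_vector_def)
  define e where "e k = (if k = 0 then i else j)" for k :: nat
  have ind': "indep_vars (\<lambda>_. borel) (\<lambda>k \<omega>. X k \<omega> ^ e k) {..<2}"
    by (rule indep_vars_compose2[OF ind]) simp
  have int: "integrable M (\<lambda>\<omega>. X k \<omega> ^ e k)" if "k \<in> {..<2}" for k
    using distributed_integrable[OF dist, of k "\<lambda>x. x ^ e k"] integrable_std_normal_moment[of "e k"] that
    by simp
  have val: "(LINT \<omega>|M. X k \<omega> ^ e k) = normal_moment (e k)" if "k \<in> {..<2}" for k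
    using distributed_integral[OF dist, of k "\<lambda>x. x ^ e k"] std_normal_integral_power[of "e k"] that
    by simp
  have two: "(\<Prod>k\<in>{..<2}. f k) = f 0 * f 1" for f :: "nat \<Rightarrow> real"
    by (simp add: numeral_2_eq_2)
  have "integrable M (\<lambda>\<omega>. \<Prod>k\<in>{..<2}. X k \<omega> ^ e k)"
    by (rule indep_vars_integrable[OF _ ind' int]) auto
  then have I: "integrable M (\<lambda>\<omega>. X 0 \<omega> ^ i * X 1 \<omega> ^ j)"
    unfolding two by (simp add: e_def)
  have "(LINT \<omega>|M. (\<Prod>k\<in>{..<2}. X k \<omega> ^ e k)) = (\<Prod>k\<in>{..<2}. LINT \<omega>|M. X k \<omega> ^ e k)"
    by (rule indep_vars_lebesgue_integral[OF _ ind' int]) auto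
  then have V: "(LINT \<omega>|M. X 0 \<omega> ^ i * X 1 \<omega> ^ j) = normal_moment i * normal_moment j"
    using val[of 0] val[of 1] unfolding two by (simp add: e_def)
  have c: "complex_of_real (X 0 \<omega>) ^ i * complex_of_real (X 1 \<omega>) ^ j = of_real (X 0 \<omega> ^ i * X 1 \<omega> ^ j)" for \<omega>
    by simp
  show ?int unfolding c using I by (rule integrable_of_real)
  show ?eq unfolding c integral_complex_of_real V ..
qed

definition Zv :: "'w \<Rightarrow> complex" where
  "Zv \<omega> = peval (\<lambda>i. complex_of_real (X i \<omega>)) Zc"

definition Wv :: "'w \<Rightarrow> complex" where
  "Wv \<omega> = peval (\<lambda>i. complex_of_real (X i \<omega>)) Wc"

lemma Zv_Wv:
  "Zv \<omega> = 1 / of_real (sqrt 2) * (of_real (X 0 \<omega>) + \<i> * of_real (X 1 \<omega>))"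
  "Wv \<omega> = 1 / of_real (sqrt 2) * (of_real (X 0 \<omega>) - \<i> * of_real (X 1 \<omega>))"
  by (simp_all only: Zv_def Wv_def Zc_def Wc_def peval_mult peval_add peval_diff peval_Const peval_Var)

lemma integrable_ZW:
  "integrable M (\<lambda>\<omega>. Zv \<omega> ^ p * Wv \<omega> ^ q)"
proof -
  let ?r = "1 / complex_of_real (sqrt 2)"
  let ?A = "\<lambda>i j p q \<omega>. complex_of_real (X 0 \<omega>) ^ i * complex_of_real (X 1 \<omega>) ^ j * (Zv \<omega> ^ p * Wv \<omega> ^ q)"
  have "integrable M (?A i j p q)" for i j
  proof (induction p arbitrary: i j)
    case 0
    show ?case
    proof (induction q arbitrary: i j)
      case 0
      then show ?case using gaussian_monomial(1) by simp
    next
      case (Suc q)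
      have "integrable M (\<lambda>\<omega>. ?r * ?A (Suc i) j 0 q \<omega> - ?r * \<i> * ?A i (Suc j) 0 q \<omega>)"
        by (intro Bochner_Integration.integrable_diff integrable_mult_right Suc)
      then show ?case
        by (rule Bochner_Integration.integrable_cong[THEN iffD1, rotated 2]) (simp_all add: Zv_Wv(2) algebra_simps)
    qed
  next
    case (Suc p)
    have "integrable M (\<lambda>\<omega>. ?r * ?A (Suc i) j p q \<omega> + ?r * \<i> * ?A i (Suc j) p q \<omega>)"
      by (intro Bochner_Integration.integrable_add integrable_mult_right Suc)
    then show ?case
      by (rule Bochner_Integration.integrable_cong[THEN iffD1, rotated 2]) (simp_all add: Zv_Wv(1) algebra_simps)
  qed
  from this[of 0 0] show ?thesis by simp
qed

lemma integral_linear_form_power: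
  fixes a b :: complex
  shows "(LINT \<omega>|M. (a * of_real (X 0 \<omega>) + b * of_real (X 1 \<omega>)) ^ n) =
    of_real (normal_moment n) * (a ^ 2 + b ^ 2) ^ (n div 2)"
proof -
  have "(LINT \<omega>|M. (a * of_real (X 0 \<omega>) + b * of_real (X 1 \<omega>)) ^ n) =
    (LINT \<omega>|M. (\<Sum>i\<le>n. of_nat (n choose i) * a ^ i * b ^ (n - i) * (of_real (X 0 \<omega>) ^ i * of_real (X 1 \<omega>) ^ (n - i))))"
    by (rule Bochner_Integration.integral_cong[OF refl]) (simp add: binomial_ring power_mult_distrib mult_ac)
  also have "\<dots> = (\<Sum>i\<le>n. of_nat (n choose i) * a ^ i * b ^ (n - i) * of_real (normal_moment i * normal_moment (n - i)))"
    by (subst Bochner_Integration.integral_sum, intro integrable_mult_right gaussian_monomial(1))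
      (simp only: integral_mult_right_zero gaussian_monomial(2))
  also have "\<dots> = of_real (normal_moment n) * (a ^ 2 + b ^ 2) ^ (n div 2)"
    by (rule sum_binomial_normal_moments)
  finally show ?thesis .
qed

text \<open>
  Compute the \<open>n\<close>-th moment of \<open>t Z + W\<close> twice.  The binomial theorem gives a polynomial in \<open>t\<close> whose
  coefficients are the mixed moments of \<open>Z\<close> and \<open>W\<close>.  On the other hand \<open>t Z + W = a X + b Y\<close> with
  \<open>a\<^sup>2 + b\<^sup>2 = 2 t\<close>, so the moment is a multiple of \<open>t ^ (n div 2)\<close>, and zero for odd \<open>n\<close>.
\<close>

lemma integral_ZW:
  "(LINT \<omega>|M. Zv \<omega> ^ a * Wv \<omega> ^ b) = (if a = b then fact a else 0)"
proof -
  define S where "S p q = (LINT \<omega>|M. Zv \<omega> ^ p * Wv \<omega> ^ q)" for p q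
  define n where "n = a + b"
  let ?r = "1 / complex_of_real (sqrt 2)"
  have rr: "?r ^ 2 = 1 / 2" using sqrt2_sq by (simp add: power2_eq_square)
  have "(\<Sum>p\<le>n. of_nat (n choose p) * S p (n - p) * t ^ p) =
      (\<Sum>p\<le>n. (if 2 * p = n then fact n / fact p else 0) * t ^ p)" for t
  proof -
    have "(\<Sum>p\<le>n. of_nat (n choose p) * S p (n - p) * t ^ p) =
        (LINT \<omega>|M. (\<Sum>p\<le>n. of_nat (n choose p) * t ^ p * (Zv \<omega> ^ p * Wv \<omega> ^ (n - p))))"
      by (subst Bochner_Integration.integral_sum)
        (auto intro!: integrable_mult_right integrable_ZW simp: S_def mult_ac)
    also have "\<dots> = (LINT \<omega>|M. (t * Zv \<omega> + Wv \<omega>) ^ n)"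
      by (rule Bochner_Integration.integral_cong[OF refl]) (simp add: binomial_ring power_mult_distrib mult_ac)
    also have "\<dots> = (LINT \<omega>|M. (?r * (t + 1) * of_real (X 0 \<omega>) + ?r * \<i> * (t - 1) * of_real (X 1 \<omega>)) ^ n)"
      by (rule Bochner_Integration.integral_cong[OF refl]) (simp add: Zv_Wv algebra_simps add_divide_distrib diff_divide_distrib)
    also have "\<dots> = of_real (normal_moment n) * ((?r * (t + 1)) ^ 2 + (?r * \<i> * (t - 1)) ^ 2) ^ (n div 2)"
      by (rule integral_linear_form_power)
    also have "(?r * (t + 1)) ^ 2 + (?r * \<i> * (t - 1)) ^ 2 = 2 * t"
      unfolding power_mult_distrib rr by (simp add: power2_eq_square algebra_simps)
    also have "of_real (normal_moment n) * (2 * t) ^ (n div 2) =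
        (\<Sum>p\<le>n. (if 2 * p = n then fact n / fact p else 0) * t ^ p)"
    proof (cases "even n")
      case True
      then obtain k where k: "n = 2 * k" by (auto elim: evenE)
      have "(\<Sum>p\<le>n. (if 2 * p = n then fact n / fact p else 0) * t ^ p) =
          (\<Sum>p\<le>n. if p = k then fact n / fact p * t ^ p else 0)"
        by (rule sum.cong) (auto simp: k)
      then show ?thesis by (simp add: k normal_moment_def power_mult_distrib)
    next
      case False
      then have "2 * p \<noteq> n" for p by auto
      then show ?thesis using False by (simp add: normal_moment_def)
    qed
    finally show ?thesis .
  qed
  then have "\<forall>p\<le>n. of_nat (n choose p) * S p (n - p) = (if 2 * p = n then fact n / fact p else 0)"
    by (subst polyfun_eq_coeffs[symmetric]) blast
  then have eq: "of_nat (n choose a) * S a b = (if a = b then fact n / fact a else 0)"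
    by (auto simp: n_def dest: spec[of _ a])
  have ch: "of_nat (n choose a) = (fact n / (fact a * fact b) :: complex)"
    by (simp add: n_def binomial_fact)
  show ?thesis
    using eq unfolding ch S_def by (auto simp: field_simps split: if_splits)
qed

lemma expect_zw_poly: "expect M X (zw_poly c) = gauss_sum c"
proof -
  have "expect M X (zw_poly c) = (LINT \<omega>|M. (\<Sum>e\<in>keys c. lookup c e * (Zv \<omega> ^ fst e * Wv \<omega> ^ snd e)))"
    unfolding expect_def peval_zw_poly Zv_def Wv_def by (simp add: case_prod_beta mult.assoc)
  also have "\<dots> = (\<Sum>e\<in>keys c. lookup c e * (if fst e = snd e then fact (fst e) else 0))"
    by (subst Bochner_Integration.integral_sum)
      (auto intro!: integrable_mult_right integrable_ZW simp: integral_ZW)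
  finally show ?thesis by (simp add: gauss_sum_def)
qed

end

section \<open>Degree in the coordinates Z and W\<close>

definition zw_degree_le :: "nat \<Rightarrow> cpoly set" where
  "zw_degree_le n = zw_poly ` {d. \<forall>e\<in>keys d. fst e + snd e \<le> n}"

lemma zw_degree_le_add:
  assumes "P \<in> zw_degree_le n" "Q \<in> zw_degree_le n"
  shows "P + Q \<in> zw_degree_le n"
proof -
  obtain p q where *: "P = zw_poly p" "\<forall>e\<in>keys p. fst e + snd e \<le> n"
    "Q = zw_poly q" "\<forall>e\<in>keys q. fst e + snd e \<le> n"
    using assms by (auto simp: zw_degree_le_def)
  have "\<forall>e\<in>keys (p + q). fst e + snd e \<le> n"
    using * Poly_Mapping.keys_add[of p q] by blast
  then show ?thesis unfolding zw_degree_le_def * zw_poly_add[symmetric] by blast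
qed

lemma zw_degree_le_mult:
  assumes "P \<in> zw_degree_le n" "Q \<in> zw_degree_le m"
  shows "P * Q \<in> zw_degree_le (n + m)"
proof -
  obtain p q where *: "P = zw_poly p" "\<forall>e\<in>keys p. fst e + snd e \<le> n"
    "Q = zw_poly q" "\<forall>e\<in>keys q. fst e + snd e \<le> m"
    using assms by (auto simp: zw_degree_le_def)
  have "\<forall>e\<in>keys (p * q). fst e + snd e \<le> n + m"
  proof
    fix e assume "e \<in> keys (p * q)"
    then obtain a b where "e = a + b" "a \<in> keys p" "b \<in> keys q"
      using Poly_Mapping.keys_mult[of p q] by blast
    then show "fst e + snd e \<le> n + m" using *(2,4) by fastforce
  qed
  then show ?thesis unfolding zw_degree_le_def * zw_poly_mult_hom[symmetric] by blast
qed

lemma zw_degree_le_mono: "n \<le> m \<Longrightarrow> zw_degree_le n \<subseteq> zw_degree_le m"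
  unfolding zw_degree_le_def by (intro image_mono Collect_mono) (meson le_trans)

lemma zw_degree_le_monomial: "a + b \<le> n \<Longrightarrow> Const r * Zc ^ a * Wc ^ b \<in> zw_degree_le n"
  unfolding zw_poly_single[symmetric] zw_degree_le_def by (rule imageI) auto

lemma zw_degree_le_Const: "Const r \<in> zw_degree_le n"
  using zw_degree_le_monomial[of 0 0 n r] by simp

lemma zw_degree_le_Var: "Var 0 \<in> zw_degree_le 1" "Var 1 \<in> zw_degree_le 1"
proof -
  let ?r = "1 / complex_of_real (sqrt 2)"
  have rr: "?r * ?r * 2 = 1" using sqrt2_sq by (simp add: field_simps)
  have "Const ?r * Zc + Const ?r * Wc = Const (?r * ?r * 2) * Var 0"
    unfolding Zc_def Wc_def Const_mult
    using Const_add[of 1 1] by (simp add: Const_1 algebra_simps)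
  then have 0: "Var 0 = Const ?r * Zc + Const ?r * Wc" unfolding rr by (simp add: Const_1)
  show "Var 0 \<in> zw_degree_le 1"
    unfolding 0 using zw_degree_le_monomial[of 1 0 1 ?r] zw_degree_le_monomial[of 0 1 1 ?r]
    by (intro zw_degree_le_add) simp_all
  have neg: "Const (- c) = - Const c" for c by (simp add: Const_def single_uminus)
  have ii: "Const \<i> * Const \<i> = - 1" by (simp add: Const_mult[symmetric] neg Const_1)
  have "Const (\<i> * ?r) * Wc - Const (\<i> * ?r) * Zc = Const (?r * ?r * 2) * (- (Const \<i> * Const \<i>) * Var 1)"
    unfolding Zc_def Wc_def Const_mult
    using Const_add[of 1 1] by (simp add: Const_1 algebra_simps)
  then have 1: "Var 1 = Const (\<i> * ?r) * Wc + Const (- (\<i> * ?r)) * Zc"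
    unfolding rr ii neg by (simp add: Const_1)
  show "Var 1 \<in> zw_degree_le 1"
    by (subst 1, intro zw_degree_le_add)
      (use zw_degree_le_monomial[of 1 0 1 "- (\<i> * ?r)"] zw_degree_le_monomial[of 0 1 1 "\<i> * ?r"] in simp_all)
qed

lemma zw_degree_le_power: "P \<in> zw_degree_le 1 \<Longrightarrow> P ^ k \<in> zw_degree_le k"
proof (induction k)
  case 0
  show ?case using zw_degree_le_Const[of 1 0] by (simp add: Const_1)
next
  case (Suc k)
  then show ?case using zw_degree_le_mult[of P 1 "P ^ k" k] by simp
qed

lemma zw_degree_le_total_degree:
  assumes "P \<in> polys 2"
  shows "P \<in> zw_degree_le (total_degree P)"
proof -
  have mono: "Poly_Mapping.single m (lookup P m) \<in> zw_degree_le (total_degree P)" if m: "m \<in> keys P" for m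
  proof -
    have km: "keys m \<subseteq> {..<2}" using assms m by (auto simp: polys_def)
    have "lookup m k = 0" if "k \<noteq> 0" "k \<noteq> 1" for k
      using km that by (metis in_keys_iff lessThan_iff less_2_cases One_nat_def subsetD)
    then have m01: "m = Poly_Mapping.single 0 (lookup m 0) + Poly_Mapping.single 1 (lookup m 1)"
      by (intro poly_mapping_eqI) (auto simp: lookup_add lookup_single when_def)
    have "(\<Sum>i\<in>keys m. lookup m i) = (\<Sum>i\<in>{..<2}. lookup m i)"
      by (rule sum.mono_neutral_left) (use km in \<open>auto simp: in_keys_iff\<close>)
    then have "lookup m 0 + lookup m 1 = (\<Sum>i\<in>keys m. lookup m i)"
      by (simp add: numeral_2_eq_2)
    also have "\<dots> \<le> total_degree P"
      unfolding total_degree_def using m by (intro Max_ge) auto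
    finally have deg: "0 + (lookup m 0 + lookup m 1) \<le> total_degree P" by simp
    have "Poly_Mapping.single m (lookup P m) = Const (lookup P m) * (Var 0 ^ lookup m 0 * Var 1 ^ lookup m 1)"
      by (subst m01) (simp add: Const_def Var_power mult_single)
    also have "\<dots> \<in> zw_degree_le (0 + (lookup m 0 + lookup m 1))"
      by (intro zw_degree_le_mult zw_degree_le_Const zw_degree_le_power zw_degree_le_Var)
    finally show ?thesis using zw_degree_le_mono[OF deg] by blast
  qed
  have "(\<Sum>m\<in>A. Poly_Mapping.single m (lookup P m)) \<in> zw_degree_le (total_degree P)"
    if "finite A" "A \<subseteq> keys P" for A
    using that
  proof (induction A rule: finite_induct)
    case empty
    then show ?case using zw_degree_le_Const[of 0] by (simp add: Const_def)
  next
    case (insert m A)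
    then show ?case using mono zw_degree_le_add by simp
  qed
  moreover have "P = (\<Sum>m\<in>keys P. Poly_Mapping.single m (lookup P m))"
    by (rule poly_mapping_eqI) (auto simp: lookup_sum lookup_single when_def in_keys_iff)
  ultimately show ?thesis by (metis finite_keys order_refl)
qed

section \<open>The Gaussian Moments Conjecture in two variables\<close>

text \<open>
  If every monomial of \<open>c\<close> has \<open>\<phi> \<ge> 1\<close>, then multiplying by \<open>c ^ m\<close> raises \<open>\<phi>\<close> by at least \<open>m\<close>, which
  removes all diagonal monomials.  It is used with \<open>\<phi>\<close> the weight or its negative.
\<close>

lemma gauss_sum_mult_power_eq_0:
  fixes \<phi> :: "nat \<times> nat \<Rightarrow> real"
  assumes add: "\<And>e e'. \<phi> (e + e') = \<phi> e + \<phi> e'" and diag: "\<And>k. \<phi> (k, k) = 0"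
    and c: "\<forall>e\<in>keys c. 1 \<le> \<phi> e" and d: "\<forall>e\<in>keys d. - real D \<le> \<phi> e" and m: "D < m"
  shows "gauss_sum (d * c ^ m) = 0"
  unfolding gauss_sum_def
proof (rule sum.neutral, rule ballI)
  fix e assume "e \<in> keys (d * c ^ m)"
  then have "- real D + real m * 1 \<le> \<phi> e"
    using keys_bound_mult[where \<phi> = \<phi>, OF add d keys_bound_power[where \<phi> = \<phi>, OF add c, of m]] by blast
  then have "\<phi> e > 0" using m by simp
  then have "fst e \<noteq> snd e" using diag by (metis less_irrefl prod.collapse)
  then show "lookup (d * c ^ m) e * (if fst e = snd e then fact (fst e) else 0) = 0" by simp
qed

theorem vanishing_moments:
  fixes M :: "'w measure"
  assumes gauss: "std_gaussian_vector M 2 X" and P: "P \<in> polys 2"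
    and moments: "\<And>m. m \<ge> 1 \<Longrightarrow> expect M X (P ^ m) = 0"
  shows "(\<forall>(a, b) \<in> zw_monomials P. int a - int b \<ge> 1) \<or> (\<forall>(a, b) \<in> zw_monomials P. int a - int b \<le> -1)"
    and "Q \<in> polys 2 \<Longrightarrow> total_degree Q < m \<Longrightarrow> expect M X (Q * P ^ m) = 0"
proof -
  define c where "c = zw_expansion P"
  have Pc: "P = zw_poly c" using zw_poly_zw_expansion[OF P] by (simp add: c_def)
  have "gauss_sum (c ^ m) = 0" if "m \<ge> 1" for m
    using moments[OF that] expect_zw_poly[OF gauss, of "c ^ m"] by (simp add: Pc zw_poly_power)
  from one_sided_weights[OF this]
  have sides: "(\<forall>e\<in>keys c. wt e \<ge> 1) \<or> (\<forall>e\<in>keys c. wt e \<le> - 1)" .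
  then show "(\<forall>(a, b) \<in> zw_monomials P. int a - int b \<ge> 1) \<or> (\<forall>(a, b) \<in> zw_monomials P. int a - int b \<le> -1)"
    by (simp add: zw_monomials_def c_def case_prod_beta)
  show "expect M X (Q * P ^ m) = 0" if Q: "Q \<in> polys 2" and m: "total_degree Q < m"
  proof -
    obtain d where d: "Q = zw_poly d" "\<forall>e\<in>keys d. fst e + snd e \<le> total_degree Q"
      using zw_degree_le_total_degree[OF Q] by (auto simp: zw_degree_le_def)
    have bound: "- real (total_degree Q) \<le> real_of_int (wt e)" "- real (total_degree Q) \<le> - real_of_int (wt e)"
      if "e \<in> keys d" for e
    proof -
      have "real (fst e + snd e) \<le> real (total_degree Q)" using d(2) that by (simp only: of_nat_le_iff)
      then show "- real (total_degree Q) \<le> real_of_int (wt e)" "- real (total_degree Q) \<le> - real_of_int (wt e)"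
        by simp_all
    qed
    have "gauss_sum (d * c ^ m) = 0"
      using sides
    proof
      assume *: "\<forall>e\<in>keys c. wt e \<ge> 1"
      show ?thesis
      proof (rule gauss_sum_mult_power_eq_0[where \<phi> = "\<lambda>e. real_of_int (wt e)"])
        show "\<forall>e\<in>keys c. 1 \<le> real_of_int (wt e)" using * by (simp only: of_int_1_le_iff)
        show "\<forall>e\<in>keys d. - real (total_degree Q) \<le> real_of_int (wt e)" using bound(1) by blast
      qed (use m in auto)
    next
      assume *: "\<forall>e\<in>keys c. wt e \<le> - 1"
      show ?thesis
      proof (rule gauss_sum_mult_power_eq_0[where \<phi> = "\<lambda>e. - real_of_int (wt e)"])
        have "\<forall>e\<in>keys c. 1 \<le> real_of_int (- wt e)" using * by (simp only: of_int_1_le_iff) force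
        then show "\<forall>e\<in>keys c. 1 \<le> - real_of_int (wt e)" by simp
        show "\<forall>e\<in>keys d. - real (total_degree Q) \<le> - real_of_int (wt e)" using bound(2) by blast
      qed (use m in auto)
    qed
    then show ?thesis
      using expect_zw_poly[OF gauss, of "d * c ^ m"] by (simp add: Pc d(1) zw_poly_mult_hom zw_poly_power)
  qed
qed

theorem theorem1:
  shows "(\<forall>(M :: 'w measure) X. std_gaussian_vector M 2 X \<longrightarrow>
            (\<forall>P \<in> polys 2. (\<forall>m\<ge>1. expect M X (P ^ m) = 0) \<longrightarrow>
               ((\<forall>(a, b) \<in> zw_monomials P. int a - int b \<ge> 1) \<or>
                (\<forall>(a, b) \<in> zw_monomials P. int a - int b \<le> -1)) \<and>
               (\<forall>Q \<in> polys 2. \<forall>m. m > total_degree Q \<longrightarrow> expect M X (Q * P ^ m) = 0)))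
         \<and> GMC 2"
proof
  show "\<forall>(M :: 'w measure) X. std_gaussian_vector M 2 X \<longrightarrow>
            (\<forall>P \<in> polys 2. (\<forall>m\<ge>1. expect M X (P ^ m) = 0) \<longrightarrow>
               ((\<forall>(a, b) \<in> zw_monomials P. int a - int b \<ge> 1) \<or>
                (\<forall>(a, b) \<in> zw_monomials P. int a - int b \<le> -1)) \<and>
               (\<forall>Q \<in> polys 2. \<forall>m. m > total_degree Q \<longrightarrow> expect M X (Q * P ^ m) = 0))"
  proof (intro allI impI ballI conjI)
    fix M :: "'w measure" and X P
    assume *: "std_gaussian_vector M 2 X" "P \<in> polys 2" "\<forall>m\<ge>1. expect M X (P ^ m) = 0"
    show "(\<forall>(a, b) \<in> zw_monomials P. int a - int b \<ge> 1) \<or> (\<forall>(a, b) \<in> zw_monomials P. int a - int b \<le> -1)"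
      using vanishing_moments(1)[OF *(1,2)] *(3) by blast
    show "expect M X (Q * P ^ m) = 0" if "Q \<in> polys 2" "m > total_degree Q" for Q m
      using vanishing_moments(2)[OF *(1,2) _ that] *(3) by blast
  qed
  show "GMC 2"
    unfolding GMC_def
  proof (intro allI impI ballI)
    fix M :: "(nat \<Rightarrow> real) measure" and X P Q
    assume *: "std_gaussian_vector M 2 X" "P \<in> polys 2" "\<forall>m\<ge>1. expect M X (P ^ m) = 0" "Q \<in> polys 2"
    have "\<forall>m\<ge>Suc (total_degree Q). expect M X (Q * P ^ m) = 0"
      using vanishing_moments(2)[OF *(1,2) _ *(4)] *(3) by (simp add: Suc_le_eq)
    then show "\<exists>N. \<forall>m\<ge>N. expect M X (Q * P ^ m) = 0" ..
  qed
qed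

end
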